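(* Let $X,Y,Z$ be standard Borel spaces and $\pi$ a kernel from $Z$ to $X\times Y$. Let $\mu$ be the kernel from $Z$ to $X$ given by $\mu^z=(\mathrm{pr}_X)_\ast\pi^z$ and $\nu$ the kernel from $Z$ to $Y$ given by $\nu^z=(\mathrm{pr}_Y)_\ast\pi^z$. Then there exists a Borel map $T:Z\times X\times[0,1]\to Y\times[0,1]$ such that for every $z\in Z$ the map $T^z:X\times[0,1]\to Y\times[0,1]$, $(x,u)\mapsto T(z,x,u)$, is a Borel isomorphism satisfying (i) $T^z_\ast(\mu^z\otimes\lambda)=\nu^z\otimes\lambda$ and (ii) $(\mathrm{pr}_{XY})_\ast(\mathrm{id},T^z)_\ast(\mu^z\otimes\lambda)=\pi^z$.
   Context: A kernel from $Z$ to $W$ is a Borel map $z\mapsto\pi^z\in\mathcal P(W)$. $\lambda$ is Lebesgue measure on $[0,1]$. $\mathrm{pr}_{XY}:X\times[0,1]\times Y\times[0,1]\to X\times Y$ is the projection. A Borel isomorphism is a Borel bijection with Borel inverse. Standing assumption: all standard Borel spaces are uncountable. *)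

theory Defs
  imports "HOL-Probability.Probability"
begin

definition I01 :: "real measure" where
  "I01 = restrict_space borel {0..1}"

definition lambda01 :: "real measure" where
  "lambda01 = restrict_space lborel {0..1}"

definition borel_iso :: "'a measure \<Rightarrow> 'b measure \<Rightarrow> ('a \<Rightarrow> 'b) \<Rightarrow> bool" where
  "borel_iso M N f \<longleftrightarrow> bij_betw f (space M) (space N) \<and> f \<in> M \<rightarrow>\<^sub>M N
     \<and> the_inv_into (space M) f \<in> N \<rightarrow>\<^sub>M M"

definition pr_XY :: "('x \<times> real) \<times> ('y \<times> real) \<Rightarrow> 'x \<times> 'y" where
  "pr_XY p = (fst (fst p), fst (snd p))"

end

theory Submission
  imports Defs
begin

text \<open>
  Disintegrate \<open>\<pi>\<^sup>z\<close> over its first marginal, \<open>\<pi>\<^sup>z = \<mu>\<^sup>z(dx) \<kappa>(z,x)(dy)\<close>, measurably in \<open>z\<close>.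
  There are Borel isomorphisms \<open>A(z,x) : [0,1] \<rightarrow> Y \<times> [0,1]\<close>, jointly measurable in \<open>(z,x)\<close>,
  carrying \<open>\<lambda>\<close> to \<open>\<kappa>(z,x) \<otimes> \<lambda>\<close>, so that \<open>(x,u) \<mapsto> (x, A(z,x)(u))\<close> carries
  \<open>\<mu>\<^sup>z \<otimes> \<lambda>\<close> to \<open>\<pi>\<^sup>z \<otimes> \<lambda>\<close>. The same construction with \<open>X\<close> and \<open>Y\<close> exchanged gives an
  isomorphism from \<open>Y \<times> [0,1]\<close>, and \<open>T\<^sup>z\<close> is the first followed by the inverse of the second.

  The isomorphism \<open>A\<close> is the quantile map of the atomless law obtained from \<open>\<kappa>(z,x) \<otimes> \<lambda>\<close> by a
  Borel embedding of \<open>Y \<times> [0,1]\<close> into a null set of reals. It is injective after a change on a null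
  set, and a Schroeder--Bernstein argument against the embedding itself, which alters it only on a
  null set, makes it bijective. The densities behind the disintegration are limits of dyadic
  difference quotients along a subsequence chosen measurably in \<open>z\<close>: these quotients form an
  \<open>L\<^sup>2\<close>-bounded martingale, whose energies tell how far along the sequence one has to go.
\<close>

section \<open>Polish spaces as Borel retracts of the real line\<close>

definition base4_value :: "(nat \<Rightarrow> bool) \<Rightarrow> real" where
  "base4_value b = (\<Sum>i. of_bool (b i) * (1 / 4) ^ Suc i)"

text \<open>Digits 0 and 1 in base 4 leave every tail at most 1/3, so greedy reading recovers the
  bits with none of the ambiguity of binary expansions. It makes sense for every real, which gives a
  Borel function on the whole line.\<close>

primrec base4_digit :: "nat \<Rightarrow> real \<Rightarrow> bool" where
  "base4_digit 0 t \<longleftrightarrow> 1 \<le> 4 * t"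
| "base4_digit (Suc i) t \<longleftrightarrow> base4_digit i (frac (4 * t))"

lemma base4_sums_third: "(\<lambda>i. (1 / 4) ^ Suc i :: real) sums (1 / 3)"
  using sums_mult[OF geometric_sums[of "1/4::real"], of "1/4"] by simp

lemma summable_base4: "summable (\<lambda>i. of_bool (b i) * (1 / 4) ^ Suc i :: real)"
  by (rule summable_comparison_test'[where N=0, OF sums_summable[OF base4_sums_third]])
     (auto simp: of_bool_def)

lemma base4_value_nonneg: "0 \<le> base4_value b"
  unfolding base4_value_def by (rule suminf_nonneg[OF summable_base4]) simp

lemma base4_value_le: "base4_value b \<le> 1 / 3"
proof -
  have "base4_value b \<le> (\<Sum>i. (1 / 4) ^ Suc i)"
    unfolding base4_value_def
    by (rule suminf_le[OF _ summable_base4 sums_summable[OF base4_sums_third]])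
       (auto simp: of_bool_def)
  then show ?thesis using sums_unique[OF base4_sums_third] by simp
qed

lemma base4_value_shift: "4 * base4_value b = of_bool (b 0) + base4_value (\<lambda>i. b (Suc i))"
proof -
  have "base4_value b = of_bool (b 0) / 4 + (\<Sum>i. of_bool (b (Suc i)) * (1 / 4) ^ Suc (Suc i))"
    unfolding base4_value_def using suminf_split_head[OF summable_base4[of b]] by simp
  also have "(\<Sum>i. of_bool (b (Suc i)) * (1 / 4) ^ Suc (Suc i))
      = (\<Sum>i. (1 / 4) * (of_bool (b (Suc i)) * (1 / 4) ^ Suc i) :: real)"
    by (intro suminf_cong) simp
  also have "\<dots> = (1 / 4) * base4_value (\<lambda>i. b (Suc i))"
    unfolding base4_value_def by (rule suminf_mult[OF summable_base4])
  finally show ?thesis by simp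
qed

lemma frac_base4_value: "frac (4 * base4_value b) = base4_value (\<lambda>i. b (Suc i))"
  unfolding base4_value_shift
  using base4_value_nonneg[of "\<lambda>i. b (Suc i)"] base4_value_le[of "\<lambda>i. b (Suc i)"]
  by (subst frac_unique_iff) auto

lemma base4_digit_value: "base4_digit i (base4_value b) = b i"
proof (induction i arbitrary: b)
  case 0
  show ?case
    using base4_value_shift[of b] base4_value_nonneg[of "\<lambda>i. b (Suc i)"]
      base4_value_le[of "\<lambda>i. b (Suc i)"]
    by (cases "b 0") auto
next
  case (Suc i)
  then show ?case by (simp add: frac_base4_value)
qed

lemma measurable_base4_digit [measurable]: "Measurable.pred borel (base4_digit i)"
proof (induction i)
  case (Suc i)
  have [measurable]: "(\<lambda>t. frac (4 * t) :: real) \<in> borel_measurable borel"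
    unfolding frac_def by measurable
  show ?case
    using measurable_compose[OF _ Suc, of "\<lambda>t. frac (4 * t)" borel] by simp
qed simp

lemma measurable_base4_value [measurable (raw)]:
  assumes [measurable]: "\<And>i. Measurable.pred M (\<lambda>x. b x i)"
  shows "(\<lambda>x. base4_value (b x)) \<in> borel_measurable M"
  unfolding base4_value_def by measurable

lemma range_base4_value_null: "range base4_value \<in> null_sets lborel"
proof -
  let ?C = "range base4_value"
  \<comment> \<open>Decoding and recoding fixes exactly the points of the range, so the range is
    Borel as a fixed-point set.\<close>
  have eq: "?C = {t \<in> space borel. base4_value (\<lambda>i. base4_digit i t) = t}"
    by (auto simp: base4_digit_value) (metis rangeI)
  have C: "?C \<in> sets borel"
    unfolding eq by measurable
  have "bounded ?C"
    by (rule bounded_subset[OF bounded_closed_interval[of 0 "1/3"]])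
       (use base4_value_nonneg base4_value_le in auto)
  then have fin: "emeasure lborel ?C < \<infinity>"
    by (rule emeasure_bounded_finite)
  let ?f = "indicator ?C :: real \<Rightarrow> real"
  have int: "integrable lborel ?f"
    using C fin by (intro integrable_real_indicator) auto
  text \<open>Self-similarity halves the measure: two copies of the set, scaled by a quarter, cover it.\<close>
  have "(\<integral>x. ?f x \<partial>lborel) \<le> (\<integral>x. ?f (0 + 4 * x) + ?f (-1 + 4 * x) \<partial>lborel)"
  proof (intro integral_mono int Bochner_Integration.integrable_add lborel_integrable_real_affine)
    fix x show "?f x \<le> ?f (0 + 4 * x) + ?f (-1 + 4 * x)"
    proof (cases "x \<in> ?C")
      case True
      then obtain b where "x = base4_value b" by auto
      with base4_value_shift[of b]
      have "0 + 4 * x = base4_value (\<lambda>i. b (Suc i)) \<or> -1 + 4 * x = base4_value (\<lambda>i. b (Suc i))"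
        by (cases "b 0") auto
      then show ?thesis
        by (auto simp: indicator_def)
    qed simp
  qed auto
  also have "\<dots> = (\<integral>x. ?f (0 + 4 * x) \<partial>lborel) + (\<integral>x. ?f (-1 + 4 * x) \<partial>lborel)"
    by (intro Bochner_Integration.integral_add lborel_integrable_real_affine int) auto
  \<comment> \<open>With m the measure of the set, each affine substitution contributes m/4, so m
    \<le> m/2; as m is finite, m = 0.\<close>
  finally have "(\<integral>x. ?f x \<partial>lborel) \<le> 0"
    using lborel_integral_real_affine[of 4 ?f 0] lborel_integral_real_affine[of 4 ?f "-1"] by simp
  then have "measure lborel ?C = 0"
    by (simp add: order_antisym)
  then show ?thesis
    using C fin by (auto simp: null_sets_def emeasure_eq_ennreal_measure)
qed

section \<open>Embedding Polish spaces into the line\<close>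

lemma dense_sequence_exists:
  "\<exists>d :: nat \<Rightarrow> 'a :: {metric_space, second_countable_topology}. \<forall>x e. 0 < e \<longrightarrow> (\<exists>k. dist x (d k) < e)"
proof -
  obtain D :: "'a set" where D: "countable D" "\<And>X. open X \<Longrightarrow> X \<noteq> {} \<Longrightarrow> \<exists>d\<in>D. d \<in> X"
    using countable_dense_exists by blast
  have "D \<noteq> {}" using D(2)[of UNIV] by auto
  have "\<exists>k. dist x (from_nat_into D k) < e" if "0 < e" for x e
  proof -
    have "\<exists>d\<in>D. d \<in> ball x e"
      using that centre_in_ball by (intro D(2)) auto
    then show ?thesis
      using from_nat_into_surj[OF D(1)] by (metis mem_ball)
  qed
  then show ?thesis by blast
qed

text \<open>The bits record which points of a dense sequence lie within which radius 2^(-n).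
  Conversely, taking for each n the first \<open>d k\<close> that the bits declare close gives
  approximations converging to the coded point.\<close>

lemma polish_space_borel_retract_of_real:
  "\<exists>(e :: 'a :: {complete_space, second_countable_topology} \<Rightarrow> real) r.
     e \<in> borel \<rightarrow>\<^sub>M borel \<and> r \<in> borel \<rightarrow>\<^sub>M borel \<and> (\<forall>x. r (e x) = x) \<and>
     range e \<subseteq> {0..1} \<and> range e \<in> null_sets lborel"
proof -
  obtain d :: "nat \<Rightarrow> 'a" where d: "\<And>x e. 0 < e \<Longrightarrow> \<exists>k. dist x (d k) < e"
    using dense_sequence_exists by blast
  define near where "near x i \<longleftrightarrow> dist x (d (snd (prod_decode i))) < (1/2) ^ fst (prod_decode i)" for x i
  have [measurable]: "Measurable.pred borel (\<lambda>x. near x i)" for i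
    unfolding near_def by measurable
  define e where "e x = base4_value (near x)" for x
  have [measurable]: "e \<in> borel \<rightarrow>\<^sub>M borel"
    unfolding e_def by measurable
  define a where "a n t = d (LEAST k. base4_digit (prod_encode (n, k)) t)" for n t
  have [measurable]: "a n \<in> borel \<rightarrow>\<^sub>M borel" for n
    unfolding a_def by (rule measurable_compose[of _ _ "count_space UNIV"]) auto
  have a_lim: "(\<lambda>n. a n (e x)) \<longlonglongrightarrow> x" for x
  proof -
    have "dist x (a n (e x)) < (1/2) ^ n" for n
      unfolding a_def e_def base4_digit_value near_def prod_encode_inverse fst_conv snd_conv
      by (rule LeastI_ex) (simp add: d)
    then have "norm (dist (a n (e x)) x) \<le> (1/2) ^ n" for n
      by (simp add: dist_commute less_imp_le)
    then have "(\<lambda>n. dist (a n (e x)) x) \<longlonglongrightarrow> 0"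
      by (intro tendsto_0_le[of "\<lambda>n. (1/2::real)^n", where K=1, OF LIMSEQ_power_zero]) auto
    then show ?thesis by (simp add: tendsto_dist_iff[symmetric])
  qed
  \<comment> \<open>An arbitrary real need not code a convergent sequence. There the approximations
    are replaced by the constant \<open>d 0\<close>, so that \<open>r\<close> is everywhere a limit
    of Borel maps.\<close>
  define good where "good t \<longleftrightarrow> Cauchy (\<lambda>n. a n t)" for t
  have [measurable]: "Measurable.pred borel good"
    unfolding good_def metric_Cauchy_iff2 by measurable
  define r where "r t = (if good t then lim (\<lambda>n. a n t) else d 0)" for t
  have "r \<in> borel \<rightarrow>\<^sub>M borel"
  proof (rule borel_measurable_LIMSEQ_metric)
    show "(\<lambda>t. if good t then a n t else d 0) \<in> borel \<rightarrow>\<^sub>M borel" for n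
      by measurable
    show "(\<lambda>n. if good t then a n t else d 0) \<longlonglongrightarrow> r t" for t
      unfolding r_def good_def by (auto simp: Cauchy_convergent_iff convergent_LIMSEQ_iff)
  qed
  moreover have "r (e x) = x" for x
    using a_lim[of x] limI[OF a_lim[of x]] LIMSEQ_imp_Cauchy[OF a_lim[of x]]
    by (simp add: r_def good_def)
  moreover have "e x \<in> {0..1}" for x
    using base4_value_nonneg[of "near x"] base4_value_le[of "near x"] by (simp add: e_def)
  then have "range e \<subseteq> {0..1}" by blast
  moreover have "range e \<in> null_sets lborel"
  proof (rule null_sets_subset[OF range_base4_value_null])
    \<comment> \<open>Again a fixed-point set, hence Borel; as a subset of
      \<open>range base4_value\<close> it is null.\<close>
    have "range e = {t \<in> space borel. e (r t) = t}"
      using \<open>\<And>x. r (e x) = x\<close> by (auto) (metis rangeI)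
    also have "\<dots> \<in> sets borel"
      using \<open>r \<in> borel \<rightarrow>\<^sub>M borel\<close> by measurable
    finally show "range e \<in> sets lborel" by simp
  qed (auto simp: e_def)
  ultimately show ?thesis
    using \<open>e \<in> borel \<rightarrow>\<^sub>M borel\<close> by blast
qed

text \<open>Follow a point of \<open>M\<close> backwards through \<open>r\<close> and
  \<open>l\<close>. If the chain stops in \<open>M\<close>, outside the range of \<open>g\<close>,
  use \<open>f\<close>; otherwise use \<open>r\<close>, the inverse of \<open>g\<close>. Given left
  inverses and measurable ranges keep every set measurable. By the last clause \<open>h\<close>
  agrees with \<open>f\<close> off the range of \<open>g\<close>.\<close>

lemma borel_schroeder_bernstein:
  assumes [measurable]: "f \<in> M \<rightarrow>\<^sub>M N" "l \<in> N \<rightarrow>\<^sub>M M" "g \<in> N \<rightarrow>\<^sub>M M" "r \<in> M \<rightarrow>\<^sub>M N"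
    and lf: "\<And>a. a \<in> space M \<Longrightarrow> l (f a) = a"
    and rg: "\<And>b. b \<in> space N \<Longrightarrow> r (g b) = b"
    and gr: "{a \<in> space M. g (r a) = a} \<in> sets M"
    and fl: "{b \<in> space N. f (l b) = b} \<in> sets N"
  obtains h k where "h \<in> M \<rightarrow>\<^sub>M N" "k \<in> N \<rightarrow>\<^sub>M M"
    "\<And>a. a \<in> space M \<Longrightarrow> k (h a) = a" "\<And>b. b \<in> space N \<Longrightarrow> h (k b) = b"
    "\<And>a. a \<in> space M \<Longrightarrow> h a = f a \<or> (g (r a) = a \<and> h a = r a)"
proof -
  have [measurable]: "Measurable.pred M (\<lambda>a. g (r a) = a)" "Measurable.pred N (\<lambda>b. f (l b) = b)"
    using gr fl by (auto simp: pred_def)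
  \<comment> \<open>\<open>A n a\<close> says that the backward chain of \<open>a\<close> first
    leaves the range of \<open>g\<close> after exactly n rounds, so \<open>P\<close> is a countable
    union of measurable sets.\<close>
  define A where "A = rec_nat (\<lambda>a. g (r a) \<noteq> a)
    (\<lambda>_ P a. g (r a) = a \<and> f (l (r a)) = r a \<and> P (l (r a)))"
  have A0: "A 0 a \<longleftrightarrow> g (r a) \<noteq> a" for a by (simp add: A_def)
  have AS: "A (Suc n) a \<longleftrightarrow> g (r a) = a \<and> f (l (r a)) = r a \<and> A n (l (r a))" for n a
    by (simp add: A_def)
  have A_meas [measurable]: "Measurable.pred M (A n)" for n
  proof (induction n)
    case 0
    then show ?case unfolding A0 by measurable
  next
    case (Suc n)
    note [measurable] = Suc
    show ?case unfolding AS[abs_def] by measurable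
  qed
  define P where "P a \<longleftrightarrow> (\<exists>n. A n a)" for a
  have [measurable]: "Measurable.pred M P" unfolding P_def by measurable
  define h where "h a = (if P a then f a else r a)" for a
  define k where "k b = (if f (l b) = b \<and> P (l b) then l b else g b)" for b
  \<comment> \<open>The backward chain of \<open>g b\<close> passes through \<open>b\<close>, so it
    stops in \<open>M\<close> exactly when \<open>b\<close> comes through \<open>f\<close> from a
    point whose chain does. Hence \<open>h\<close> and \<open>k\<close> choose their branches
    consistently.\<close>
  have step: "P (g b) \<longleftrightarrow> f (l b) = b \<and> P (l b)" if "b \<in> space N" for b
  proof
    assume "P (g b)"
    then obtain n where "A n (g b)" by (auto simp: P_def)
    with rg[OF that] show "f (l b) = b \<and> P (l b)"
      by (cases n) (auto simp: A0 AS P_def)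
  next
    assume "f (l b) = b \<and> P (l b)"
    then obtain n where "A n (l b)" "f (l b) = b" by (auto simp: P_def)
    then have "A (Suc n) (g b)" using rg[OF that] by (simp add: AS)
    then show "P (g b)" unfolding P_def by blast
  qed
  have notP: "g (r a) = a" if "\<not> P a" for a
    using that A0 by (auto simp: P_def)
  show thesis
  proof
    show "h \<in> M \<rightarrow>\<^sub>M N" unfolding h_def by measurable
    show "k \<in> N \<rightarrow>\<^sub>M M" unfolding k_def by measurable
    show "h (k b) = b" if "b \<in> space N" for b
      using step[OF that] rg[OF that] by (auto simp: h_def k_def)
    show "k (h a) = a" if "a \<in> space M" for a
    proof (cases "P a")
      case True
      then show ?thesis using lf[OF that] by (simp add: h_def k_def)
    next
      case False
      have "r a \<in> space N" using that by (rule measurable_space[OF assms(4)])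
      from step[OF this] notP[OF False] False show ?thesis by (auto simp: h_def k_def)
    qed
    show "h a = f a \<or> (g (r a) = a \<and> h a = r a)" if "a \<in> space M" for a
      using notP[of a] by (auto simp: h_def)
  qed
qed

section \<open>Radon--Nikodym derivatives of kernels\<close>

text \<open>The two measures at one fixed parameter. Domination bounds the density by 1, so
  everything below is bounded and lies in L^2.\<close>

locale dominated_measures =
  fixes \<rho> \<mu> :: "real measure"
  assumes sets_rho [measurable_cong]: "sets \<rho> = sets borel"
    and sets_mu [measurable_cong]: "sets \<mu> = sets borel"
    and subprob_mu: "subprob_space \<mu>"
    and dominated: "\<And>A. A \<in> sets borel \<Longrightarrow> emeasure \<rho> A \<le> emeasure \<mu> A"
begin

sublocale mu: subprob_space \<mu> by (rule subprob_mu)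

lemma space_mu [simp]: "space \<mu> = UNIV" and space_rho [simp]: "space \<rho> = UNIV"
  using sets_mu sets_rho by (auto dest: sets_eq_imp_space_eq)

sublocale rho: finite_measure \<rho>
  using dominated[of UNIV] by (intro finite_measureI) (auto simp: top_unique mu.emeasure_eq_measure)

lemma measure_rho_le: "A \<in> sets borel \<Longrightarrow> measure \<rho> A \<le> measure \<mu> A"
  using dominated[of A] by (simp add: mu.emeasure_eq_measure rho.emeasure_eq_measure)

end

text \<open>The conditional expectation of \<open>d\<rho>/d\<mu>\<close> on the dyadic cells of level \<open>n\<close>
  (it is \<open>0\<close> on cells that are \<open>\<mu>\<close>-null).\<close>
definition cell_ratio :: "real measure \<Rightarrow> real measure \<Rightarrow> nat \<Rightarrow> int \<Rightarrow> real" where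
  "cell_ratio \<rho> \<mu> n i = measure \<rho> {y. \<lfloor>2 ^ n * y\<rfloor> = i} / measure \<mu> {y. \<lfloor>2 ^ n * y\<rfloor> = i}"

definition dyadic_ratio :: "real measure \<Rightarrow> real measure \<Rightarrow> nat \<Rightarrow> real \<Rightarrow> real" where
  "dyadic_ratio \<rho> \<mu> n x = cell_ratio \<rho> \<mu> n \<lfloor>2 ^ n * x\<rfloor>"

text \<open>The squared L^2 norm of the martingale at level n; its increments are squared L^2
  distances between levels.\<close>

definition dyadic_energy :: "real measure \<Rightarrow> real measure \<Rightarrow> nat \<Rightarrow> real" where
  "dyadic_energy \<rho> \<mu> n = (\<integral>x. (dyadic_ratio \<rho> \<mu> n x)\<^sup>2 \<partial>\<mu>)"

text \<open>This is the nesting of the dyadic partitions: a function of the coarse cell is also a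
  function of the fine one.\<close>

lemma floor_dyadic_coarsen:
  fixes x :: real
  assumes "n \<le> m"
  shows "\<lfloor>2 ^ n * x\<rfloor> = \<lfloor>2 ^ m * x\<rfloor> div 2 ^ (m - n)"
proof -
  have "(2::real) ^ m = 2 ^ n * 2 ^ (m - n)"
    using assms by (simp flip: power_add)
  then have "2 ^ n * x = 2 ^ m * x / real_of_int (2 ^ (m - n))"
    unfolding of_int_power of_int_numeral by simp
  then show ?thesis
    using floor_divide_real_eq_div[of "2 ^ (m - n)" "2 ^ m * x"] by simp
qed

lemma dyadic_cell_borel [measurable]: "{y :: real. \<lfloor>2 ^ n * y\<rfloor> = i} \<in> sets borel"
proof -
  have "{y \<in> space borel. \<lfloor>2 ^ n * y :: real\<rfloor> = i} \<in> sets borel" by measurable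
  then show ?thesis by simp
qed

section \<open>The dyadic martingale and its limit\<close>

context dominated_measures
begin

abbreviation "R \<equiv> dyadic_ratio \<rho> \<mu>"
abbreviation "E \<equiv> dyadic_energy \<rho> \<mu>"

lemma cell_ratio_bounds: "0 \<le> cell_ratio \<rho> \<mu> n i" "cell_ratio \<rho> \<mu> n i \<le> 1"
  using measure_rho_le[of "{y. \<lfloor>2 ^ n * y\<rfloor> = i}"]
  by (auto simp: cell_ratio_def divide_le_eq_1 zero_less_measure_iff less_le)

lemma R_bounds: "0 \<le> R n x" "R n x \<le> 1"
  by (auto simp: dyadic_ratio_def cell_ratio_bounds)

lemma R_measurable [measurable]: "R n \<in> borel_measurable borel"
  unfolding dyadic_ratio_def by measurable

text \<open>After both measures are pushed forward to the countable set of cell indices, the cell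
  ratio is the density of one with respect to the other.\<close>

lemma integral_R_same_level:
  fixes h :: "int \<Rightarrow> real"
  shows "(\<integral>x. R n x * h \<lfloor>2 ^ n * x\<rfloor> \<partial>\<mu>) = (\<integral>x. h \<lfloor>2 ^ n * x\<rfloor> \<partial>\<rho>)"
proof -
  let ?c = "\<lambda>x::real. \<lfloor>2 ^ n * x\<rfloor>"
  let ?g = "cell_ratio \<rho> \<mu> n"
  have [measurable]: "?c \<in> borel \<rightarrow>\<^sub>M count_space UNIV" by measurable
  have vi: "?c -` {i} = {y. \<lfloor>2 ^ n * y\<rfloor> = i}" for i by auto
  have eq: "distr \<rho> (count_space UNIV) ?c
      = density (distr \<mu> (count_space UNIV) ?c) (\<lambda>i. ennreal (?g i))"
  proof (rule measure_eqI_countable[of _ UNIV])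
    fix i :: int
    let ?I = "{y::real. \<lfloor>2 ^ n * y\<rfloor> = i}"
    have "emeasure (density (distr \<mu> (count_space UNIV) ?c) (\<lambda>i. ennreal (?g i))) {i}
        = (\<integral>\<^sup>+j. ennreal (?g i) * indicator {i} j \<partial>distr \<mu> (count_space UNIV) ?c)"
      by (subst emeasure_density) (auto intro!: nn_integral_cong simp: indicator_def)
    also have "\<dots> = ennreal (?g i) * emeasure \<mu> ?I"
      by (subst nn_integral_cmult_indicator) (auto simp: emeasure_distr vi)
    also have "\<dots> = ennreal (?g i * measure \<mu> ?I)"
      by (simp add: mu.emeasure_eq_measure ennreal_mult' cell_ratio_bounds)
    \<comment> \<open>On a cell of \<open>\<mu>\<close>-mass 0 domination makes the
      \<open>\<rho>\<close>-mass 0 too, so the convention for division by zero gives the right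
      value.\<close>
    also have "?g i * measure \<mu> ?I = measure \<rho> ?I"
      using measure_rho_le[of ?I] by (auto simp: cell_ratio_def intro: antisym)
    finally show "emeasure (distr \<rho> (count_space UNIV) ?c) {i}
        = emeasure (density (distr \<mu> (count_space UNIV) ?c) (\<lambda>i. ennreal (?g i))) {i}"
      by (simp add: emeasure_distr vi rho.emeasure_eq_measure)
  qed auto
  have "(\<integral>x. h (?c x) \<partial>\<rho>) = (\<integral>i. h i \<partial>distr \<rho> (count_space UNIV) ?c)"
    by (subst integral_distr) auto
  also have "\<dots> = (\<integral>i. ?g i * h i \<partial>distr \<mu> (count_space UNIV) ?c)"
    unfolding eq by (subst integral_density) (auto simp: cell_ratio_bounds)
  also have "\<dots> = (\<integral>x. R n x * h (?c x) \<partial>\<mu>)"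
    by (subst integral_distr) (auto simp: dyadic_ratio_def)
  finally show ?thesis ..
qed

text \<open>The martingale property in integrated form: a test function of the level-n cell is one
  of the level-m cell too, so every finer level has the same integral against it.\<close>

lemma integral_R:
  fixes h :: "int \<Rightarrow> real"
  assumes "n \<le> m"
  shows "(\<integral>x. R m x * h \<lfloor>2 ^ n * x\<rfloor> \<partial>\<mu>) = (\<integral>x. h \<lfloor>2 ^ n * x\<rfloor> \<partial>\<rho>)"
  using integral_R_same_level[of m "\<lambda>i. h (i div 2 ^ (m - n))"]
  by (simp add: floor_dyadic_coarsen[OF assms])

lemma integrable_bounded_mu:
  fixes f :: "real \<Rightarrow> real"
  assumes "f \<in> borel_measurable borel" "\<And>x. \<bar>f x\<bar> \<le> c"
  shows "integrable \<mu> f"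
  using assms by (intro mu.integrable_const_bound[of _ c]) auto

lemma R_products_integrable: "integrable \<mu> (\<lambda>x. R m x * R n x)"
  using R_bounds by (intro integrable_bounded_mu[of _ 1]) (auto simp: abs_mult intro!: mult_le_one)

text \<open>Orthogonality of martingale increments: testing against \<open>R n\<close> itself shows
  that the cross term equals \<open>E n\<close>.\<close>

lemma energy_diff:
  assumes "n \<le> m"
  shows "(\<integral>x. (R m x - R n x)\<^sup>2 \<partial>\<mu>) = E m - E n"
proof -
  have "(\<integral>x. R m x * R n x \<partial>\<mu>) = E n"
    using integral_R[OF assms, of "cell_ratio \<rho> \<mu> n"] integral_R_same_level[of n "cell_ratio \<rho> \<mu> n"]
    by (simp add: dyadic_energy_def dyadic_ratio_def power2_eq_square)
  moreover have "(\<integral>x. (R m x - R n x)\<^sup>2 \<partial>\<mu>) = E m - 2 * (\<integral>x. R m x * R n x \<partial>\<mu>) + E n"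
    using R_products_integrable[of m m] R_products_integrable[of n n] R_products_integrable[of m n]
    by (simp add: dyadic_energy_def power2_eq_square algebra_simps)
  ultimately show ?thesis by simp
qed

lemma energy_mono: "n \<le> m \<Longrightarrow> E n \<le> E m"
  using energy_diff[of n m] integral_nonneg_AE[of "\<lambda>x. (R m x - R n x)\<^sup>2" \<mu>] by simp

lemma energy_le_1: "E n \<le> 1"
proof -
  have "E n \<le> (\<integral>x. 1 \<partial>\<mu>)"
    unfolding dyadic_energy_def
    using R_products_integrable[of n n] R_bounds
    by (intro integral_mono) (auto simp: power2_eq_square intro!: mult_le_one)
  also have "\<dots> \<le> 1" using mu.subprob_measure_le_1 by simp
  finally show ?thesis .
qed

text \<open>Increasing bounded energies converge. The existence of a stable index is what later
  allows a choice of the least one, measurable in the parameter.\<close>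

lemma energy_eventually_stable:
  assumes "0 < \<epsilon>"
  shows "\<exists>n. \<forall>m\<ge>n. E m - E n \<le> \<epsilon>"
proof -
  obtain L where L: "E \<longlonglongrightarrow> L" "\<forall>i. E i \<le> L"
    using incseq_convergent[of E 1] energy_mono energy_le_1 by (auto simp: incseq_def)
  have "eventually (\<lambda>n. L - \<epsilon> < E n) sequentially"
    using L(1) assms by (intro order_tendstoD) auto
  then obtain n where "L - \<epsilon> < E n" by (auto simp: eventually_sequentially)
  then have "E m - E n \<le> \<epsilon>" for m using L(2)[rule_format, of m] by linarith
  then show ?thesis by blast
qed

text \<open>Along these levels the increments have L^2 norm at most 2^(-k), hence also L^1 norm at
  most 2^(-k), as the total mass is at most 1. The L^1 norms are summable, so the telescoping series
  converges absolutely almost everywhere.\<close>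

lemma R_subsequence_convergent_AE:
  assumes mono: "\<And>k. N k \<le> N (Suc k)"
    and N: "\<And>k m. N k \<le> m \<Longrightarrow> E m - E (N k) \<le> (1 / 4) ^ k"
  shows "AE x in \<mu>. convergent (\<lambda>k. R (N k) x)"
proof -
  define D where "D k x = R (N (Suc k)) x - R (N k) x" for k x
  have [measurable]: "D k \<in> borel_measurable borel" for k unfolding D_def by measurable
  have Db: "\<bar>D k x\<bar> \<le> 1" for k x
    using R_bounds[of "N (Suc k)" x] R_bounds[of "N k" x] by (auto simp: D_def)
  have int: "integrable \<mu> (\<lambda>x. \<bar>D k x\<bar>)" for k
    using Db by (intro integrable_bounded_mu[of _ 1]) auto
  have int2: "integrable \<mu> (\<lambda>x. (D k x)\<^sup>2)" for k
    using Db by (intro integrable_bounded_mu[of _ 1]) (auto simp: abs_square_le_1)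
  have L1: "(\<integral>x. \<bar>D k x\<bar> \<partial>\<mu>) \<le> (1 / 2) ^ k" for k
  proof -
    have "(\<integral>x. \<bar>D k x\<bar> \<partial>\<mu>) \<le> (\<integral>x. (1/2) * (1/2) ^ k + (1/2) * 2 ^ k * (D k x)\<^sup>2 \<partial>\<mu>)"
    proof (intro integral_mono int Bochner_Integration.integrable_add integrable_mult_right int2)
      fix x
      text \<open>AM-GM\<close>
      have "0 \<le> (1 - 2 ^ k * \<bar>D k x\<bar>)\<^sup>2" by simp
      then have "2 * (2 ^ k * \<bar>D k x\<bar>) \<le> 1 + 2 ^ k * (2 ^ k * (D k x)\<^sup>2)"
        by (simp add: power2_eq_square algebra_simps flip: abs_mult)
      then show "\<bar>D k x\<bar> \<le> (1/2) * (1/2) ^ k + (1/2) * 2 ^ k * (D k x)\<^sup>2"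
        by (simp add: field_simps)
    qed auto
    also have "\<dots> = (1/2) * (1/2) ^ k * measure \<mu> UNIV + (1/2) * 2 ^ k * (\<integral>x. (D k x)\<^sup>2 \<partial>\<mu>)"
      using int2 by simp
    also have "\<dots> \<le> (1/2) * (1/2) ^ k * 1 + (1/2) * 2 ^ k * (1/4) ^ k"
      unfolding D_def energy_diff[OF mono]
      using N[OF mono] mu.subprob_measure_le_1 by (intro add_mono mult_left_mono) auto
    also have "\<dots> = (1 / 2) ^ k"
      by (simp add: field_simps power_mult_distrib[symmetric])
    finally show ?thesis .
  qed
  have "(\<integral>\<^sup>+x. (\<Sum>k. ennreal \<bar>D k x\<bar>) \<partial>\<mu>) = (\<Sum>k. \<integral>\<^sup>+x. ennreal \<bar>D k x\<bar> \<partial>\<mu>)"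
    by (rule nn_integral_suminf) measurable
  also have "\<dots> \<le> (\<Sum>k. ennreal ((1/2) ^ k))"
    using int L1 by (intro suminf_le) (auto simp: nn_integral_eq_integral ennreal_leI)
  also have "\<dots> = ennreal (\<Sum>k. (1/2) ^ k)"
    by (rule suminf_ennreal2) (auto simp: summable_geometric)
  also have "\<dots> < \<infinity>" by simp
  finally have "AE x in \<mu>. (\<Sum>k. ennreal \<bar>D k x\<bar>) \<noteq> \<infinity>"
    by (intro nn_integral_PInf_AE) auto
  then show ?thesis
  proof eventually_elim
    case (elim x)
    then have "summable (\<lambda>k. \<bar>D k x\<bar>)"
      by (intro summable_suminf_not_top) auto
    then have "summable (\<lambda>k. D k x)"
      by (rule summable_rabs_cancel)
    then have "convergent (\<lambda>n. (\<Sum>k<n. D k x) + R (N 0) x)"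
      by (intro convergent_add convergent_const) (simp add: summable_iff_convergent)
    then show ?case
      by (simp add: D_def sum_lessThan_telescope[of "\<lambda>k. R (N k) x"])
  qed
qed

text \<open>Once the level reaches n, the ratios integrate over a union of level-n cells to its
  \<open>\<rho>\<close>-mass; dominated convergence passes this on to \<open>g\<close>. Such unions
  exhaust every half-line.\<close>

lemma density_limit_of_R:
  assumes [measurable]: "g \<in> borel_measurable borel"
    and g: "\<And>x. 0 \<le> g x" "\<And>x. g x \<le> 1"
    and N: "\<And>k. k \<le> N k"
    and lim: "AE x in \<mu>. (\<lambda>k. R (N k) x) \<longlonglongrightarrow> g x"
  shows "\<rho> = density \<mu> (\<lambda>x. ennreal (g x))"
proof (rule measure_eqI_lessThan)
  fix a :: real
  \<comment> \<open>The level-n cells strictly to the right of the cell of \<open>a\<close>;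
    omitting that cell keeps \<open>S n\<close> inside \<open>{a<..}\<close>.\<close>
  define S where "S n = {x::real. \<lfloor>2 ^ n * a\<rfloor> < \<lfloor>2 ^ n * x\<rfloor>}" for n :: nat
  have [measurable]: "S n \<in> sets borel" for n
  proof -
    have "{x \<in> space borel. \<lfloor>2 ^ n * a\<rfloor> < \<lfloor>2 ^ n * x :: real\<rfloor>} \<in> sets borel" by measurable
    then show ?thesis by (simp add: S_def)
  qed
  have S_eq: "emeasure (density \<mu> (\<lambda>x. ennreal (g x))) (S n) = emeasure \<rho> (S n)" for n
  proof -
    have intg: "integrable \<mu> (\<lambda>x. g x * indicator (S n) x)"
      using g by (intro integrable_bounded_mu[of _ 1]) (auto simp: indicator_def)
    have "(\<lambda>k. \<integral>x. R (N k) x * indicator (S n) x \<partial>\<mu>) \<longlonglongrightarrow> (\<integral>x. g x * indicator (S n) x \<partial>\<mu>)"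
    proof (rule integral_dominated_convergence[where w="\<lambda>_. 1"])
      show "AE x in \<mu>. (\<lambda>k. R (N k) x * indicator (S n) x) \<longlonglongrightarrow> g x * indicator (S n) x"
        using lim by eventually_elim (intro tendsto_intros)
    qed (use R_bounds in \<open>auto simp: indicator_def\<close>)
    moreover have "eventually (\<lambda>k. (\<integral>x. R (N k) x * indicator (S n) x \<partial>\<mu>) = measure \<rho> (S n)) sequentially"
      using eventually_ge_at_top[of n]
    proof eventually_elim
      case (elim k)
      then have "n \<le> N k" using N[of k] by simp
      from integral_R[OF this, of "indicator {\<lfloor>2 ^ n * a\<rfloor><..}"]
      have "(\<integral>x. R (N k) x * indicator (S n) x \<partial>\<mu>) = (\<integral>x. indicator (S n) x \<partial>\<rho>)"
        by (simp add: S_def indicator_def)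
      then show ?case by simp
    qed
    then have "(\<lambda>k. \<integral>x. R (N k) x * indicator (S n) x \<partial>\<mu>) \<longlonglongrightarrow> measure \<rho> (S n)"
      by (rule tendsto_eventually)
    ultimately have eq: "(\<integral>x. g x * indicator (S n) x \<partial>\<mu>) = measure \<rho> (S n)"
      by (rule LIMSEQ_unique)
    have "emeasure (density \<mu> (\<lambda>x. ennreal (g x))) (S n)
        = (\<integral>\<^sup>+x. ennreal (g x * indicator (S n) x) \<partial>\<mu>)"
      by (subst emeasure_density) (auto intro!: nn_integral_cong simp: indicator_def)
    also have "\<dots> = emeasure \<rho> (S n)"
      using intg g by (subst nn_integral_eq_integral) (auto simp: eq rho.emeasure_eq_measure)
    finally show ?thesis .
  qed
  have inc: "incseq S"
  proof (rule incseq_SucI, rule subsetI)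
    fix n x assume "x \<in> S n"
    then have *: "\<lfloor>2 ^ Suc n * a\<rfloor> div 2 < \<lfloor>2 ^ Suc n * x\<rfloor> div 2"
      using floor_dyadic_coarsen[of n "Suc n" a] floor_dyadic_coarsen[of n "Suc n" x] by (simp add: S_def)
    show "x \<in> S (Suc n)"
    proof (rule ccontr)
      assume "x \<notin> S (Suc n)"
      then have "\<lfloor>2 ^ Suc n * x\<rfloor> \<le> \<lfloor>2 ^ Suc n * a\<rfloor>" by (simp add: S_def)
      from zdiv_mono1[OF this, of 2] * show False by simp
    qed
  qed
  have "(\<Union>n. S n) = {a<..}"
  proof safe
    fix x n assume "x \<in> S n"
    then have "\<not> 2 ^ n * x \<le> 2 ^ n * a"
      using floor_mono[of "2 ^ n * x" "2 ^ n * a"] by (auto simp: S_def)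
    then show "a < x" by simp
  next
    fix x assume "a < x"
    \<comment> \<open>Once the cells are shorter than x - a, the two points lie in different
      cells.\<close>
    then obtain n where "1 / (x - a) < 2 ^ n"
      using real_arch_pow[of 2 "1 / (x - a)"] by auto
    then have "2 ^ n * a + 1 \<le> 2 ^ n * x"
      using \<open>a < x\<close> by (simp add: field_simps)
    then have "x \<in> S n" by (simp add: S_def) linarith
    then show "x \<in> (\<Union>n. S n)" by blast
  qed
  then show "emeasure \<rho> {a<..} = emeasure (density \<mu> (\<lambda>x. ennreal (g x))) {a<..}"
    using SUP_emeasure_incseq[of S \<rho>] SUP_emeasure_incseq[of S "density \<mu> (\<lambda>x. ennreal (g x))"] inc
    by (simp add: S_eq image_subset_iff sets_rho sets_mu)
qed (auto simp: sets_rho sets_mu less_top[symmetric])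

end

text \<open>Derivatives chosen separately for each z would carry no measurability in z. Here the
  derivative is a limit of explicit ratios along levels that depend measurably on z.\<close>

lemma kernel_radon_nikodym:
  fixes \<rho> \<mu> :: "'z \<Rightarrow> real measure"
  assumes [measurable]: "\<rho> \<in> M \<rightarrow>\<^sub>M subprob_algebra borel" "\<mu> \<in> M \<rightarrow>\<^sub>M subprob_algebra borel"
    and le: "\<And>z A. z \<in> space M \<Longrightarrow> A \<in> sets borel \<Longrightarrow> emeasure (\<rho> z) A \<le> emeasure (\<mu> z) A"
  obtains g :: "'z \<times> real \<Rightarrow> real" where "g \<in> borel_measurable (M \<Otimes>\<^sub>M borel)"
    "\<And>w. 0 \<le> g w" "\<And>w. g w \<le> 1"
    "\<And>z. z \<in> space M \<Longrightarrow> \<rho> z = density (\<mu> z) (\<lambda>x. ennreal (g (z, x)))"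
proof -
  have dom: "dominated_measures (\<rho> z) (\<mu> z)" if "z \<in> space M" for z
    using that le subprob_space_kernel[OF assms(2)] sets_kernel[OF assms(1)] sets_kernel[OF assms(2)]
    by (intro dominated_measures.intro)
  have R_meas [measurable]: "(\<lambda>w. dyadic_ratio (\<rho> (fst w)) (\<mu> (fst w)) n (snd w)) \<in> borel_measurable (M \<Otimes>\<^sub>M borel)" for n
    unfolding dyadic_ratio_def
  \<comment> \<open>The cell index depends on the point; it suffices to treat each of its countably
    many values separately.\<close>
  proof (rule measurable_compose_countable[of "\<lambda>i w. cell_ratio (\<rho> (fst w)) (\<mu> (fst w)) n i"])
    show "(\<lambda>w. cell_ratio (\<rho> (fst w)) (\<mu> (fst w)) n i) \<in> borel_measurable (M \<Otimes>\<^sub>M borel)" for i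
      unfolding cell_ratio_def by measurable
  qed measurable
  define Ez where "Ez n z = dyadic_energy (\<rho> z) (\<mu> z) n" for n z
  have E_meas [measurable]: "Ez n \<in> borel_measurable M" for n
  proof -
    have "(\<lambda>z. enn2real (\<integral>\<^sup>+x. ennreal ((dyadic_ratio (\<rho> z) (\<mu> z) n x)\<^sup>2) \<partial>\<mu> z)) \<in> borel_measurable M"
      by (intro borel_measurable_enn2real nn_integral_measurable_subprob_algebra2[OF _ assms(2)])
         (use R_meas in \<open>simp add: split_beta'\<close>)
    also have "?this \<longleftrightarrow> Ez n \<in> borel_measurable M"
    proof (rule measurable_cong)
      fix z assume z: "z \<in> space M"
      interpret dominated_measures "\<rho> z" "\<mu> z" using dom[OF z] .
      show "enn2real (\<integral>\<^sup>+x. ennreal ((dyadic_ratio (\<rho> z) (\<mu> z) n x)\<^sup>2) \<partial>\<mu> z) = Ez n z"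
        unfolding Ez_def dyadic_energy_def
        by (subst integral_eq_nn_integral) (auto simp: measurable_cong_sets[OF sets_mu refl])
    qed
    finally show ?thesis .
  qed
  \<comment> \<open>The first level after which the energy gains at most 4^(-k). As a least index
    over countably many measurable conditions it is measurable in z.\<close>
  define L where "L k z = (LEAST n. \<forall>m. n \<le> m \<longrightarrow> Ez m z - Ez n z \<le> (1/4) ^ k)" for k z
  have L_meas [measurable]: "L k \<in> M \<rightarrow>\<^sub>M count_space UNIV" for k
    unfolding L_def by measurable
  \<comment> \<open>Adding k drives the levels to infinity even where the energy is stable from the
    start; since energies increase, the bound persists at the later level.\<close>
  define N where "N k z = k + L k z" for k z
  have N_meas [measurable]: "N k \<in> M \<rightarrow>\<^sub>M count_space UNIV" for k
    unfolding N_def by measurable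
  define G where "G w = lim (\<lambda>k. dyadic_ratio (\<rho> (fst w)) (\<mu> (fst w)) (N k (fst w)) (snd w))" for w
  have [measurable]: "G \<in> borel_measurable (M \<Otimes>\<^sub>M borel)"
    unfolding G_def
  proof (rule borel_measurable_lim_metric)
    show "(\<lambda>w. dyadic_ratio (\<rho> (fst w)) (\<mu> (fst w)) (N k (fst w)) (snd w)) \<in> borel_measurable (M \<Otimes>\<^sub>M borel)" for k
      by (rule measurable_compose_countable[of "\<lambda>n w. dyadic_ratio (\<rho> (fst w)) (\<mu> (fst w)) n (snd w)"]) measurable
  qed
  \<comment> \<open>Where the ratios diverge, \<open>lim\<close> is arbitrary; clamping secures the
    bounds there and changes nothing where they converge.\<close>
  define g where "g w = max 0 (min 1 (G w))" for w
  show thesis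
  proof
    show "g \<in> borel_measurable (M \<Otimes>\<^sub>M borel)" unfolding g_def by measurable
    show "0 \<le> g w" "g w \<le> 1" for w by (auto simp: g_def)
    fix z assume z: "z \<in> space M"
    interpret dominated_measures "\<rho> z" "\<mu> z" using dom[OF z] .
    have L: "Ez m z - Ez (L k z) z \<le> (1/4) ^ k" if "L k z \<le> m" for k m
      using LeastI_ex[OF energy_eventually_stable[of "(1/4) ^ k"]] that
      by (simp add: L_def Ez_def)
    have L_mono: "L k z \<le> L (Suc k) z" for k
      unfolding L_def[of k]
    proof (rule Least_le, intro allI impI)
      fix m assume "L (Suc k) z \<le> m"
      from L[OF this] have "Ez m z - Ez (L (Suc k) z) z \<le> (1/4) ^ Suc k" .
      also have "\<dots> \<le> (1/4) ^ k" by simp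
      finally show "Ez m z - Ez (L (Suc k) z) z \<le> (1/4) ^ k" .
    qed
    have conv: "AE x in \<mu> z. convergent (\<lambda>k. dyadic_ratio (\<rho> z) (\<mu> z) (N k z) x)"
    proof (rule R_subsequence_convergent_AE)
      show "N k z \<le> N (Suc k) z" for k using L_mono[of k] by (simp add: N_def)
      show "dyadic_energy (\<rho> z) (\<mu> z) m - dyadic_energy (\<rho> z) (\<mu> z) (N k z) \<le> (1/4) ^ k"
        if "N k z \<le> m" for k m
        using L[of k m] energy_mono[of "L k z" "N k z"] that by (simp add: N_def Ez_def)
    qed
    show "\<rho> z = density (\<mu> z) (\<lambda>x. ennreal (g (z, x)))"
    proof (rule density_limit_of_R[where N="\<lambda>k. N k z"])
      show "(\<lambda>x. g (z, x)) \<in> borel_measurable borel"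
        using z unfolding g_def by measurable
      show "AE x in \<mu> z. (\<lambda>k. dyadic_ratio (\<rho> z) (\<mu> z) (N k z) x) \<longlonglongrightarrow> g (z, x)"
        using conv
      proof eventually_elim
        case (elim x)
        then have "(\<lambda>k. dyadic_ratio (\<rho> z) (\<mu> z) (N k z) x) \<longlonglongrightarrow> G (z, x)"
          by (simp add: G_def convergent_LIMSEQ_iff)
        moreover from this have "0 \<le> G (z, x)" "G (z, x) \<le> 1"
          by (auto intro: LIMSEQ_le_const LIMSEQ_le_const2 R_bounds)
        ultimately show ?case by (simp add: g_def)
      qed
    qed (auto simp: g_def N_def)
  qed
qed

section \<open>Quantile functions\<close>

lemma sets_lambda01 [measurable_cong]: "sets lambda01 = sets I01"
  by (simp add: lambda01_def I01_def sets_restrict_space)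

lemma space_I01 [simp]: "space I01 = {0..1}" and space_lambda01 [simp]: "space lambda01 = {0..1}"
  by (simp_all add: I01_def lambda01_def space_restrict_space)

lemma prob_space_lambda01: "prob_space lambda01"
  by (rule prob_spaceI) (simp add: lambda01_def emeasure_restrict_space space_restrict_space)

lemma emeasure_lambda01: "A \<subseteq> {0..1} \<Longrightarrow> emeasure lambda01 A = emeasure lborel A"
  by (simp add: lambda01_def emeasure_restrict_space)

lemma measurable_I01_borel: "f \<in> borel \<rightarrow>\<^sub>M M \<Longrightarrow> f \<in> I01 \<rightarrow>\<^sub>M M"
  unfolding I01_def by (rule measurable_restrict_space1)

lemma measurable_snd_I01: "snd \<in> M \<Otimes>\<^sub>M I01 \<rightarrow>\<^sub>M borel"
  using measurable_compose[OF measurable_snd measurable_I01_borel[of "\<lambda>x. x" borel]] by simp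

lemma measurable_into_I01:
  "f \<in> M \<rightarrow>\<^sub>M borel \<Longrightarrow> (\<And>x. x \<in> space M \<Longrightarrow> f x \<in> {0..1}) \<Longrightarrow> f \<in> M \<rightarrow>\<^sub>M I01"
  unfolding I01_def by (rule measurable_restrict_space2) auto

lemma sets_I01_subset_borel: "A \<in> sets I01 \<longleftrightarrow> A \<in> sets borel \<and> A \<subseteq> {0..1}"
  unfolding I01_def by (subst sets_restrict_space_iff) auto

lemma kernel_prob:
  assumes "K \<in> M \<rightarrow>\<^sub>M prob_algebra N" "z \<in> space M"
  shows "prob_space (K z)" "sets (K z) = sets N"
  using measurable_space[OF assms] by (auto simp: space_prob_algebra)

text \<open>A pseudo-inverse of the survival function \<open>h\<close>; \<open>0\<close> is always admitted, so that the
  supremum is over a nonempty set.\<close>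
definition quantile :: "(real \<Rightarrow> real) \<Rightarrow> real \<Rightarrow> real" where
  "quantile h u = Sup {q \<in> \<rat> \<inter> {0..1}. q = 0 \<or> u \<le> h q}"

lemma quantile_set: "{q \<in> \<rat> \<inter> {0..1}. q = 0 \<or> u \<le> h q} \<noteq> {}" "bdd_above {q \<in> \<rat> \<inter> {0..1::real}. q = 0 \<or> u \<le> h q}"
  by (auto intro!: exI[of _ 0] bdd_aboveI[of _ 1])

text \<open>Strict inequality below a supremum turns superlevel sets into countable unions over
  rationals. Both the measurability and the law of the quantile rest on this.\<close>

lemma quantile_greater_iff:
  "t < quantile h u \<longleftrightarrow> (\<exists>q\<in>\<rat> \<inter> {0..1}. (q = 0 \<or> u \<le> h q) \<and> t < q)"
  unfolding quantile_def by (subst less_cSup_iff[OF quantile_set]) auto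

lemma quantile_bounds: "0 \<le> quantile h u" "quantile h u \<le> 1"
  unfolding quantile_def by (auto intro!: cSup_upper cSup_least quantile_set)

lemma quantile_antimono: "u \<le> v \<Longrightarrow> quantile h v \<le> quantile h u"
  unfolding quantile_def by (intro cSup_subset_mono quantile_set) auto

lemma measurable_quantile:
  assumes [measurable]: "\<And>q. q \<in> \<rat> \<Longrightarrow> (\<lambda>w. h w q) \<in> borel_measurable M"
  shows "(\<lambda>p. quantile (h (fst p)) (snd p)) \<in> borel_measurable (M \<Otimes>\<^sub>M borel)"
proof (rule borel_measurableI_greater)
  fix t :: real
  have "{p \<in> space (M \<Otimes>\<^sub>M borel). t < quantile (h (fst p)) (snd p)}
      = (\<Union>q\<in>\<rat> \<inter> {0..1} \<inter> {t<..}. {p \<in> space (M \<Otimes>\<^sub>M borel). q = 0 \<or> snd p \<le> h (fst p) q})"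
    by (auto simp: quantile_greater_iff)
  also have "\<dots> \<in> sets (M \<Otimes>\<^sub>M borel)"
  proof (rule sets.countable_UN'')
    show "countable (\<rat> \<inter> {0..1} \<inter> {t<..})"
      by (intro countable_Int1) (rule countable_rat)
    show "{p \<in> space (M \<Otimes>\<^sub>M borel). q = 0 \<or> snd p \<le> h (fst p) q} \<in> sets (M \<Otimes>\<^sub>M borel)"
      if "q \<in> \<rat> \<inter> {0..1} \<inter> {t<..}" for q
    proof -
      have [measurable]: "(\<lambda>w. h w q) \<in> borel_measurable M" using that by auto
      show ?thesis by measurable
    qed
  qed
  finally show "{p \<in> space (M \<Otimes>\<^sub>M borel). t < quantile (h (fst p)) (snd p)} \<in> sets (M \<Otimes>\<^sub>M borel)" .
qed

lemma rational_sequence_from_above: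
  fixes t :: real
  assumes "0 \<le> t" "t < 1"
  obtains q :: "nat \<Rightarrow> real" where "decseq q" "\<And>k. q k \<in> \<rat> \<inter> {0..1}" "\<And>k. t < q k" "q \<longlonglongrightarrow> t"
proof -
  \<comment> \<open>The right endpoints of the dyadic cells containing t: strictly above t,
    decreasing because the cells are nested, and at most 1 because t < 1.\<close>
  define q where "q k = (real_of_int \<lfloor>2 ^ k * t\<rfloor> + 1) / 2 ^ k" for k :: nat
  have gt: "t < q k" for k
    using floor_correct[of "2 ^ k * t"] by (simp add: q_def field_simps)
  have le: "q k \<le> t + (1/2) ^ k" for k
    using floor_correct[of "2 ^ k * t"] by (simp add: q_def field_simps)
  show thesis
  proof
    show "decseq q"
    proof (rule decseq_SucI)
      fix k
      have "\<lfloor>2 ^ Suc k * t\<rfloor> < 2 * \<lfloor>2 ^ k * t\<rfloor> + 2"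
        using floor_correct[of "2 ^ k * t"] by (simp add: floor_less_iff algebra_simps)
      then have "\<lfloor>2 ^ Suc k * t\<rfloor> + 1 \<le> 2 * \<lfloor>2 ^ k * t\<rfloor> + 2" by simp
      then have "real_of_int (\<lfloor>2 ^ Suc k * t\<rfloor> + 1) \<le> real_of_int (2 * \<lfloor>2 ^ k * t\<rfloor> + 2)"
        by (simp only: of_int_le_iff)
      then have "real_of_int (\<lfloor>2 ^ Suc k * t\<rfloor> + 1) / 2 ^ Suc k \<le> real_of_int (2 * \<lfloor>2 ^ k * t\<rfloor> + 2) / 2 ^ Suc k"
        by (rule divide_right_mono) simp
      also have "\<dots> = q k" by (simp add: q_def field_simps)
      finally show "q (Suc k) \<le> q k" by (simp add: q_def)
    qed
    show "q k \<in> \<rat> \<inter> {0..1}" for k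
    proof -
      have "\<lfloor>2 ^ k * t\<rfloor> < 2 ^ k"
        using assms by (simp add: floor_less_iff)
      then have "real_of_int (\<lfloor>2 ^ k * t\<rfloor> + 1) \<le> real_of_int (2 ^ k)"
        by (simp only: of_int_le_iff)
      then have "q k \<le> 1" by (simp add: q_def)
      moreover have "q k \<in> \<rat>" by (simp add: q_def)
      moreover have "0 \<le> q k" using gt[of k] assms by simp
      ultimately show ?thesis by simp
    qed
    show "t < q k" for k by (rule gt)
    show "q \<longlonglongrightarrow> t"
    proof (rule tendsto_sandwich[of "\<lambda>_. t"])
      show "(\<lambda>k. t + (1/2) ^ k) \<longlonglongrightarrow> t"
        using tendsto_add[OF tendsto_const[of t] LIMSEQ_power_zero[of "1/2::real"]] by simp
    qed (use gt le in \<open>auto simp: less_imp_le\<close>)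
  qed
qed

text \<open>For antitone \<open>h\<close>, some rational r > t has u \<le> h r exactly when some
  \<open>q k\<close> does, so the superlevel set is the increasing union of the intervals from 0 to
  \<open>h (q k)\<close>. Monotonicity is asked at rationals only, because conditional survival
  functions have it almost surely just on a countable set.\<close>

lemma emeasure_quantile_greater:
  assumes h: "\<And>q. 0 \<le> h q" "\<And>q. h q \<le> 1"
    and anti: "\<And>q r. q \<in> \<rat> \<inter> {0..1} \<Longrightarrow> r \<in> \<rat> \<inter> {0..1} \<Longrightarrow> q \<le> r \<Longrightarrow> h r \<le> h q"
    and "0 \<le> t" and q: "decseq q" "\<And>k. q k \<in> \<rat> \<inter> {0..1}" "\<And>k. t < q k" "q \<longlonglongrightarrow> t"
  shows "emeasure lambda01 {u \<in> {0..1}. t < quantile h u} = (SUP k. ennreal (h (q k)))"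
proof -
  have "{u \<in> {0..1}. t < quantile h u} = (\<Union>k. {0..h (q k)})"
  proof safe
    fix u assume u: "u \<in> {0..1}" "t < quantile h u"
    then obtain r where r: "r \<in> \<rat> \<inter> {0..1}" "u \<le> h r" "t < r"
      using \<open>0 \<le> t\<close> by (auto simp: quantile_greater_iff)
    have "eventually (\<lambda>k. q k < r) sequentially"
      using q(4) r(3) by (rule order_tendstoD)
    then obtain k where "q k < r" by (auto simp: eventually_sequentially)
    then have "h r \<le> h (q k)" using anti[OF q(2) r(1)] by simp
    then have "u \<in> {0..h (q k)}" using u r by simp
    then show "u \<in> (\<Union>k. {0..h (q k)})" by blast
  next
    fix k u assume "u \<in> {0..h (q k)}"
    then show "u \<in> {0..1}" "t < quantile h u"
      using h(2)[of "q k"] q(2)[of k] q(3)[of k] by (auto simp: quantile_greater_iff intro!: bexI[of _ "q k"])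
  qed
  also have "emeasure lambda01 \<dots> = (SUP k. emeasure lambda01 {0..h (q k)})"
  proof (rule SUP_emeasure_incseq[symmetric])
    show "range (\<lambda>k. {0..h (q k)}) \<subseteq> sets lambda01"
      using h by (auto simp: sets_lambda01 sets_I01_subset_borel intro: order_trans)
    show "incseq (\<lambda>k. {0..h (q k)})"
    proof (rule incseq_SucI)
      fix k
      have "h (q k) \<le> h (q (Suc k))"
        using q(2) decseq_SucD[OF q(1)] by (intro anti) auto
      then show "{0..h (q k)} \<subseteq> {0..h (q (Suc k))}" by simp
    qed
  qed
  also have "(\<lambda>k. emeasure lambda01 {0..h (q k)}) = (\<lambda>k. ennreal (h (q k)))"
  proof
    show "emeasure lambda01 {0..h (q k)} = ennreal (h (q k))" for k
      using h[of "q k"] by (subst emeasure_lambda01) auto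
  qed
  finally show ?thesis .
qed

section \<open>Comparison of measures and of densities\<close>

lemma emeasure_times_greaterThan_SUP:
  fixes N :: "('a \<times> real) measure"
  assumes N: "sets N = sets (M \<Otimes>\<^sub>M borel)" and B: "B \<in> sets M"
    and q: "decseq q" "\<And>k. t < q k" "q \<longlonglongrightarrow> t"
  shows "emeasure N (B \<times> {t<..}) = (SUP k. emeasure N (B \<times> {q k<..}))"
proof -
  have "B \<times> {t<..} = (\<Union>k. B \<times> {q k<..})"
  proof safe
    fix x y assume "x \<in> B" "t < y"
    have "eventually (\<lambda>k. q k < y) sequentially"
      using q(3) \<open>t < y\<close> by (rule order_tendstoD)
    with \<open>x \<in> B\<close> show "(x, y) \<in> (\<Union>k. B \<times> {q k<..})" by (auto simp: eventually_sequentially)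
  qed (use q(2) in \<open>auto intro: less_trans\<close>)
  also have "emeasure N \<dots> = (SUP k. emeasure N (B \<times> {q k<..}))"
  proof (rule SUP_emeasure_incseq[symmetric])
    show "range (\<lambda>k. B \<times> {q k<..}) \<subseteq> sets N"
      using B by (auto simp: N)
    show "incseq (\<lambda>k. B \<times> {q k<..})"
      using decseq_SucD[OF q(1)] by (intro incseq_SucI) (auto intro: le_less_trans)
  qed
  finally show ?thesis .
qed

lemma measure_eqI_times_greaterThan:
  fixes N1 N2 :: "('a \<times> real) measure"
  assumes sets: "sets N1 = sets (M \<Otimes>\<^sub>M borel)" "sets N2 = sets (M \<Otimes>\<^sub>M borel)"
    and fin: "finite_measure N1"
    and eq: "\<And>B t. B \<in> sets M \<Longrightarrow> emeasure N1 (B \<times> {t<..}) = emeasure N2 (B \<times> {t<..})"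
  shows "N1 = N2"
proof -
  interpret finite_measure N1 by fact
  note [measurable_cong] = sets
  have rect: "emeasure N1 (B \<times> C) = emeasure N2 (B \<times> C)" if B: "B \<in> sets M" and C: "C \<in> sets borel" for B C
  proof -
    \<comment> \<open>Restricting to B \<times> UNIV by an indicator density and projecting realises
      C \<mapsto> N(B \<times> C) as a measure.\<close>
    let ?D = "\<lambda>N. distr (density N (indicator (B \<times> UNIV))) borel snd"
    have BU: "B \<times> UNIV \<in> sets (M \<Otimes>\<^sub>M (borel :: real measure))"
      using B pair_measureI[of B M UNIV borel] by simp
    have D: "emeasure (?D N) C = emeasure N (B \<times> C)"
      if C [measurable]: "C \<in> sets borel" and N [measurable_cong]: "sets N = sets (M \<Otimes>\<^sub>M borel)"
      for N :: "('a \<times> real) measure" and C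
    proof -
      have [measurable]: "B \<times> UNIV \<in> sets N"
        using N BU by simp
      have "emeasure (?D N) C = emeasure (density N (indicator (B \<times> UNIV))) (snd -` C \<inter> space N)"
        by (subst emeasure_distr) auto
      also have "\<dots> = (\<integral>\<^sup>+p. indicator (B \<times> C) p \<partial>N)"
        by (subst emeasure_density) (auto intro!: nn_integral_cong simp: indicator_def)
      also have "\<dots> = emeasure N (B \<times> C)"
        using B by (subst nn_integral_indicator) auto
      finally show ?thesis .
    qed
    have "?D N1 = ?D N2"
    proof (rule measure_eqI_lessThan)
      fix t :: real
      show "emeasure (?D N1) {t<..} < \<infinity>"
        by (simp add: D sets less_top[symmetric])
      show "emeasure (?D N1) {t<..} = emeasure (?D N2) {t<..}"
        by (simp add: D sets eq[OF B])
    qed auto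
    then show ?thesis using D[OF C sets(1)] D[OF C sets(2)] by simp
  qed
  show ?thesis
  proof (rule measure_eqI_generator_eq[OF Int_stable_pair_measure_generator[of M borel]])
    show "{a \<times> b |a b. a \<in> sets M \<and> b \<in> sets borel} \<subseteq> Pow (space M \<times> space (borel :: real measure))"
      by (rule pair_measure_closed)
    show "sets N1 = sigma_sets (space M \<times> space borel) {a \<times> b |a b. a \<in> sets M \<and> b \<in> sets borel}"
      "sets N2 = sigma_sets (space M \<times> space borel) {a \<times> b |a b. a \<in> sets M \<and> b \<in> sets borel}"
      by (simp_all add: sets sets_pair_measure)
    show "range (\<lambda>_::nat. space M \<times> space borel) \<subseteq> {a \<times> b |a b. a \<in> sets M \<and> b \<in> sets borel}"
      by blast
    show "emeasure N1 (space M \<times> space borel) \<noteq> \<infinity>"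
      by simp
    show "emeasure N1 A = emeasure N2 A" if "A \<in> {a \<times> b |a b. a \<in> sets M \<and> b \<in> sets borel}" for A
      using that rect by auto
  qed simp
qed

text \<open>Test on the set where g < f: if it had positive mass, the integral of g over it, finite
  because g is bounded, would be strictly below that of f.\<close>

lemma density_le_imp_AE_le:
  fixes f g :: "'a \<Rightarrow> real"
  assumes "finite_measure M"
    and [measurable]: "f \<in> borel_measurable M" "g \<in> borel_measurable M"
    and g: "\<And>x. 0 \<le> g x" "\<And>x. g x \<le> 1"
    and le: "\<And>A. A \<in> sets M \<Longrightarrow> emeasure (density M f) A \<le> emeasure (density M g) A"
  shows "AE x in M. f x \<le> g x"
proof -
  interpret finite_measure M by fact
  define A where "A = {x \<in> space M. g x < f x}"
  have [measurable]: "A \<in> sets M" unfolding A_def by measurable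
  have "AE x in M. ennreal (f x) * indicator A x \<le> ennreal (g x) * indicator A x"
  proof (rule ccontr)
    assume "\<not> ?thesis"
    moreover have "(\<integral>\<^sup>+x. ennreal (g x) * indicator A x \<partial>M) \<le> (\<integral>\<^sup>+x. 1 \<partial>M)"
      using g by (intro nn_integral_mono) (auto simp: indicator_def)
    then have "(\<integral>\<^sup>+x. ennreal (g x) * indicator A x \<partial>M) \<noteq> \<infinity>"
      by (auto simp: top_unique)
    ultimately have "(\<integral>\<^sup>+x. ennreal (g x) * indicator A x \<partial>M) < (\<integral>\<^sup>+x. ennreal (f x) * indicator A x \<partial>M)"
      by (intro nn_integral_less) (auto simp: A_def indicator_def intro!: ennreal_leI)
    with le[of A] show False by (simp add: emeasure_density)
  qed
  with AE_space show ?thesis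
  proof eventually_elim
    case (elim x)
    with g[of x] show ?case
      by (cases "x \<in> A") (auto simp: A_def)
  qed
qed

section \<open>Disintegration of kernels\<close>

lemma measurable_lambda01_const [measurable]: "(\<lambda>_. lambda01) \<in> M \<rightarrow>\<^sub>M prob_algebra I01"
  by (rule measurable_const) (simp add: space_prob_algebra sets_lambda01 prob_space_lambda01)

lemma measurable_quantile_I01:
  assumes "\<And>q. q \<in> \<rat> \<Longrightarrow> (\<lambda>w. h w q) \<in> borel_measurable M"
  shows "(\<lambda>(w, u). quantile (h w) u) \<in> M \<Otimes>\<^sub>M I01 \<rightarrow>\<^sub>M borel"
proof -
  have "(\<lambda>p. quantile (h (fst p)) (snd p)) \<circ> (\<lambda>p. (fst p, snd p)) \<in> M \<Otimes>\<^sub>M I01 \<rightarrow>\<^sub>M borel"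
    by (rule measurable_comp[OF _ measurable_quantile[OF assms]])
       (intro measurable_Pair measurable_fst measurable_snd_I01)
  then show ?thesis by (simp add: comp_def split_beta')
qed

text \<open>The density \<open>g q\<close> of B \<mapsto> \<pi>(B \<times> {q<..}) against the first
  marginal is the conditional probability that the second coordinate exceeds q. The quantile of
  these values at rational q defines the conditional law.\<close>

lemma disintegration_real:
  fixes \<pi> :: "'z \<Rightarrow> (real \<times> real) measure"
  assumes \<pi> [measurable]: "\<pi> \<in> M \<rightarrow>\<^sub>M prob_algebra (borel \<Otimes>\<^sub>M borel)"
    and supp: "\<And>z. z \<in> space M \<Longrightarrow> AE p in \<pi> z. snd p \<in> {0..1}"
  obtains \<kappa> :: "'z \<times> real \<Rightarrow> real measure"
  where "\<kappa> \<in> M \<Otimes>\<^sub>M borel \<rightarrow>\<^sub>M prob_algebra borel"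
    "\<And>z f. z \<in> space M \<Longrightarrow> f \<in> borel_measurable (borel \<Otimes>\<^sub>M borel) \<Longrightarrow>
      (\<integral>\<^sup>+x. \<integral>\<^sup>+y. f (x, y) \<partial>\<kappa> (z, x) \<partial>distr (\<pi> z) borel fst) = (\<integral>\<^sup>+p. f p \<partial>\<pi> z)"
proof -
  have sub [measurable]: "\<pi> \<in> M \<rightarrow>\<^sub>M subprob_algebra (borel \<Otimes>\<^sub>M borel)"
    by (rule measurable_prob_algebraD[OF \<pi>])
  define \<mu> where "\<mu> z = distr (\<pi> z) borel fst" for z
  have mu_meas [measurable]: "\<mu> \<in> M \<rightarrow>\<^sub>M prob_algebra borel"
    unfolding \<mu>_def by measurable
  define \<rho> where "\<rho> q z = distr (restrict_space (\<pi> z) (UNIV \<times> {q<..})) borel fst" for q z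
  have rho_meas: "\<rho> q \<in> M \<rightarrow>\<^sub>M subprob_algebra borel" for q
    unfolding \<rho>_def
  proof (rule measurable_compose[OF restrict_space_measurable[OF _ _ sub] measurable_distr])
    show "UNIV \<times> {q<..} \<noteq> {}" using gt_ex[of q] by auto
  qed (auto intro!: measurable_restrict_space1)
  have rho: "emeasure (\<rho> q z) B = emeasure (\<pi> z) (B \<times> {q<..})"
    if z: "z \<in> space M" and B [measurable]: "B \<in> sets borel" for q z B
  proof -
    note [measurable_cong] = kernel_prob(2)[OF \<pi> z]
    have U: "UNIV \<times> {q<..} \<in> sets (\<pi> z)"
      by (simp add: kernel_prob(2)[OF \<pi> z])
    have "emeasure (\<rho> q z) B
        = emeasure (restrict_space (\<pi> z) (UNIV \<times> {q<..})) (fst -` B \<inter> space (restrict_space (\<pi> z) (UNIV \<times> {q<..})))"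
      unfolding \<rho>_def
      by (rule emeasure_distr) (auto intro!: measurable_restrict_space1 simp: measurable_cong_sets[OF kernel_prob(2)[OF \<pi> z] refl])
    also have "fst -` B \<inter> space (restrict_space (\<pi> z) (UNIV \<times> {q<..})) = B \<times> {q<..}"
      using sets_eq_imp_space_eq[OF kernel_prob(2)[OF \<pi> z]]
      by (auto simp: space_restrict_space space_pair_measure)
    also have "emeasure (restrict_space (\<pi> z) (UNIV \<times> {q<..})) (B \<times> {q<..}) = emeasure (\<pi> z) (B \<times> {q<..})"
      using U by (intro emeasure_restrict_space) (auto simp: sets.Int_space_eq2)
    finally show ?thesis .
  qed
  have mu: "emeasure (\<mu> z) B = emeasure (\<pi> z) (B \<times> UNIV)"
    if z: "z \<in> space M" and B [measurable]: "B \<in> sets borel" for z B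
  proof -
    note [measurable_cong] = kernel_prob(2)[OF \<pi> z]
    show ?thesis
      unfolding \<mu>_def using sets_eq_imp_space_eq[OF kernel_prob(2)[OF \<pi> z]]
      by (subst emeasure_distr) (auto simp: space_pair_measure measurable_cong_sets[OF kernel_prob(2)[OF \<pi> z] refl] intro!: arg_cong[where f="emeasure (\<pi> z)"])
  qed
  have "\<exists>g :: 'z \<times> real \<Rightarrow> real. g \<in> borel_measurable (M \<Otimes>\<^sub>M borel) \<and> (\<forall>w. 0 \<le> g w \<and> g w \<le> 1) \<and>
      (\<forall>z\<in>space M. \<rho> q z = density (\<mu> z) (\<lambda>x. ennreal (g (z, x))))" for q
  proof (rule kernel_radon_nikodym[OF rho_meas[of q] measurable_prob_algebraD[OF mu_meas]])
    show "emeasure (\<rho> q z) A \<le> emeasure (\<mu> z) A" if "z \<in> space M" "A \<in> sets borel" for z A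
      unfolding rho[OF that] mu[OF that]
      using that by (intro emeasure_mono) (auto simp: kernel_prob(2)[OF \<pi>])
  qed blast
  then obtain g :: "real \<Rightarrow> 'z \<times> real \<Rightarrow> real"
    where g_meas [measurable]: "\<And>q. g q \<in> borel_measurable (M \<Otimes>\<^sub>M borel)"
      and g_bounds: "\<And>q w. 0 \<le> g q w" "\<And>q w. g q w \<le> 1"
      and g: "\<And>q z. z \<in> space M \<Longrightarrow> \<rho> q z = density (\<mu> z) (\<lambda>x. ennreal (g q (z, x)))"
    by metis
  define Q where "Q w = quantile (\<lambda>q. g q w)" for w
  have Q_meas: "(\<lambda>(w, u). Q w u) \<in> (M \<Otimes>\<^sub>M borel) \<Otimes>\<^sub>M I01 \<rightarrow>\<^sub>M borel"
    unfolding Q_def by (rule measurable_quantile_I01) measurable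
  \<comment> \<open>As an image of \<open>lambda01\<close> this is a probability measure for every
    w, even where the \<open>g q\<close> fail to be antitone in q.\<close>
  define \<kappa> where "\<kappa> w = distr lambda01 borel (Q w)" for w
  have kappa_meas: "\<kappa> \<in> M \<Otimes>\<^sub>M borel \<rightarrow>\<^sub>M prob_algebra borel"
    unfolding \<kappa>_def by (rule measurable_distr_prob_space2[OF measurable_lambda01_const Q_meas])
  show thesis
  proof (rule that[OF kappa_meas])
    fix z and f :: "real \<times> real \<Rightarrow> ennreal"
    assume z: "z \<in> space M" and f [measurable]: "f \<in> borel_measurable (borel \<Otimes>\<^sub>M borel)"
    note sets_pi [measurable_cong] = kernel_prob(2)[OF \<pi> z]
    note sets_mu [measurable_cong] = kernel_prob(2)[OF mu_meas z]
    interpret mu: prob_space "\<mu> z" by (rule kernel_prob(1)[OF mu_meas z])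
    interpret pi: prob_space "\<pi> z" by (rule kernel_prob(1)[OF \<pi> z])
    interpret lam: prob_space lambda01 by (rule prob_space_lambda01)
    interpret ml: pair_prob_space "\<mu> z" lambda01 ..
    have gz_meas [measurable]: "(\<lambda>x. g q (z, x)) \<in> borel_measurable borel" for q
      using z by measurable
    have "(\<lambda>(w, u). Q w u) \<circ> (\<lambda>(x, u). ((z, x), u)) \<in> borel \<Otimes>\<^sub>M I01 \<rightarrow>\<^sub>M borel"
      by (rule measurable_comp[OF _ Q_meas]) (use z in measurable)
    then have Qz_meas [measurable]: "(\<lambda>(x, u). Q (z, x) u) \<in> borel \<Otimes>\<^sub>M I01 \<rightarrow>\<^sub>M borel"
      by (simp add: comp_def split_beta')
    have [measurable]: "Q (z, x) \<in> I01 \<rightarrow>\<^sub>M borel" for x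
      using measurable_Pair2[OF Qz_meas, of x] by simp
    \<comment> \<open>Each pair q \<le> r has its own exceptional null set; restricting to rationals
      leaves a single one.\<close>
    have mono: "AE x in \<mu> z. \<forall>q\<in>\<rat> \<inter> {0..1}. \<forall>r\<in>\<rat> \<inter> {0..1}. q \<le> r \<longrightarrow> g r (z, x) \<le> g q (z, x)"
    proof -
      have "AE x in \<mu> z. g r (z, x) \<le> g q (z, x)" if "q \<le> r" for q r
      proof (rule density_le_imp_AE_le)
        fix A assume "A \<in> sets (\<mu> z)"
        then have A: "A \<in> sets borel" by (simp add: sets_mu)
        show "emeasure (density (\<mu> z) (\<lambda>x. ennreal (g r (z, x)))) A
            \<le> emeasure (density (\<mu> z) (\<lambda>x. ennreal (g q (z, x)))) A"
          unfolding g[OF z, symmetric] rho[OF z A]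
          using A that by (intro emeasure_mono) (auto simp: sets_pi)
      next
        show "(\<lambda>x. g r (z, x)) \<in> borel_measurable (\<mu> z)" "(\<lambda>x. g q (z, x)) \<in> borel_measurable (\<mu> z)"
          by measurable
      qed (use g_bounds mu.finite_measure_axioms in auto)
      then show ?thesis
        by (simp add: AE_ball_countable countable_rat)
    qed
    \<comment> \<open>The joint law of x drawn from the marginal and y drawn by the quantile at x.
      Once it equals \<open>\<pi> z\<close>, the disintegration formula is a change of
      variables.\<close>
    define N where "N = distr (\<mu> z \<Otimes>\<^sub>M lambda01) (borel \<Otimes>\<^sub>M borel) (\<lambda>(x, u). (x, Q (z, x) u))"
    have N_rect: "emeasure N (B \<times> C) = (\<integral>\<^sup>+x. emeasure lambda01 {u \<in> {0..1}. Q (z, x) u \<in> C} * indicator B x \<partial>\<mu> z)"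
      if [measurable]: "B \<in> sets borel" "C \<in> sets borel" for B C
    proof -
      have "emeasure N (B \<times> C) = emeasure (\<mu> z \<Otimes>\<^sub>M lambda01) ((\<lambda>(x, u). (x, Q (z, x) u)) -` (B \<times> C) \<inter> space (\<mu> z \<Otimes>\<^sub>M lambda01))"
        unfolding N_def by (rule emeasure_distr) auto
      also have "\<dots> = (\<integral>\<^sup>+x. emeasure lambda01 (Pair x -` ((\<lambda>(x, u). (x, Q (z, x) u)) -` (B \<times> C) \<inter> space (\<mu> z \<Otimes>\<^sub>M lambda01))) \<partial>\<mu> z)"
        by (rule lam.emeasure_pair_measure_alt) measurable
      also have "\<dots> = (\<integral>\<^sup>+x. emeasure lambda01 {u \<in> {0..1}. Q (z, x) u \<in> C} * indicator B x \<partial>\<mu> z)"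
      proof (rule nn_integral_cong)
        fix x
        have "Pair x -` ((\<lambda>(x, u). (x, Q (z, x) u)) -` (B \<times> C) \<inter> space (\<mu> z \<Otimes>\<^sub>M lambda01))
            = (if x \<in> B then {u \<in> {0..1}. Q (z, x) u \<in> C} else {})"
          using sets_eq_imp_space_eq[OF sets_mu] by (auto simp: space_pair_measure)
        then show "emeasure lambda01 (Pair x -` ((\<lambda>(x, u). (x, Q (z, x) u)) -` (B \<times> C) \<inter> space (\<mu> z \<Otimes>\<^sub>M lambda01)))
            = emeasure lambda01 {u \<in> {0..1}. Q (z, x) u \<in> C} * indicator B x"
          by simp
      qed
      finally show ?thesis .
    qed
    have "N = \<pi> z"
    proof (rule measure_eqI_times_greaterThan[where M=borel])
      show "finite_measure N"
        unfolding N_def by (intro ml.P.finite_measure_distr) measurable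
      fix B :: "real set" and t :: real assume B [measurable]: "B \<in> sets borel"
      have N_eq: "emeasure N (B \<times> {t<..}) = (\<integral>\<^sup>+x. emeasure lambda01 {u \<in> {0..1}. t < Q (z, x) u} * indicator B x \<partial>\<mu> z)"
        using N_rect[OF B, of "{t<..}"] by simp
      \<comment> \<open>Thresholds outside [0,1) follow from the support condition and the bounds on
        the quantile; the others can be approached by rationals of [0,1] from above.\<close>
      consider "t < 0" | "1 \<le> t" | "0 \<le> t" "t < 1" by linarith
      then show "emeasure N (B \<times> {t<..}) = emeasure (\<pi> z) (B \<times> {t<..})"
      proof cases
        case 1
        then have "t < Q w u" for w u
          using quantile_bounds(1)[of "\<lambda>q. g q w" u] by (simp add: Q_def)
        then have "{u \<in> {0..1}. t < Q (z, x) u} = {0..1}" for x by blast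
        then have "emeasure N (B \<times> {t<..}) = emeasure (\<mu> z) B"
          unfolding N_eq using lam.emeasure_space_1 by (simp add: sets_mu)
        also have "\<dots> = emeasure (\<pi> z) (B \<times> {t<..})"
          unfolding mu[OF z B]
          using supp[OF z] 1 by (intro emeasure_eq_AE) (auto simp: sets_pi)
        finally show ?thesis .
      next
        case 2
        then have "\<not> t < Q w u" for w u
          using quantile_bounds(2)[of "\<lambda>q. g q w" u] by (simp add: Q_def)
        then have "emeasure N (B \<times> {t<..}) = 0"
          unfolding N_eq by simp
        also have "\<dots> = emeasure (\<pi> z) {}" by simp
        also have "\<dots> = emeasure (\<pi> z) (B \<times> {t<..})"
          using supp[OF z] 2 by (intro emeasure_eq_AE) (auto simp: sets_pi)
        finally show ?thesis .
      next
        case 3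
        obtain q :: "nat \<Rightarrow> real"
          where q: "decseq q" "\<And>k. q k \<in> \<rat> \<inter> {0..1}" "\<And>k. t < q k" "q \<longlonglongrightarrow> t"
          using rational_sequence_from_above[OF 3] by blast
        have "emeasure N (B \<times> {t<..}) = (\<integral>\<^sup>+x. (SUP k. ennreal (g (q k) (z, x)) * indicator B x) \<partial>\<mu> z)"
          unfolding N_eq
        proof (rule nn_integral_cong_AE, use mono in eventually_elim)
          case (elim x)
          have "emeasure lambda01 {u \<in> {0..1}. t < Q (z, x) u} = (SUP k. ennreal (g (q k) (z, x)))"
            unfolding Q_def using elim
            by (intro emeasure_quantile_greater q g_bounds 3) auto
          then show ?case by (simp add: SUP_mult_right_ennreal)
        qed
        also have "\<dots> = (SUP k. \<integral>\<^sup>+x. ennreal (g (q k) (z, x)) * indicator B x \<partial>\<mu> z)"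
        proof (rule nn_integral_monotone_convergence_SUP_AE)
          show "AE x in \<mu> z. ennreal (g (q k) (z, x)) * indicator B x \<le> ennreal (g (q (Suc k)) (z, x)) * indicator B x" for k
            using mono
          proof eventually_elim
            case (elim x)
            then have "g (q k) (z, x) \<le> g (q (Suc k)) (z, x)"
              using q(2) decseq_SucD[OF q(1), of k] by blast
            then show ?case by (intro mult_right_mono ennreal_leI) auto
          qed
        qed measurable
        also have "\<dots> = (SUP k. emeasure (\<pi> z) (B \<times> {q k<..}))"
          by (simp add: rho[OF z B, symmetric] g[OF z] emeasure_density)
        also have "\<dots> = emeasure (\<pi> z) (B \<times> {t<..})"
          by (rule emeasure_times_greaterThan_SUP[symmetric, OF sets_pi B q(1) q(3) q(4)])
        finally show ?thesis .
      qed
    qed (auto simp: N_def sets_pi)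
    have "(\<integral>\<^sup>+x. \<integral>\<^sup>+y. f (x, y) \<partial>\<kappa> (z, x) \<partial>\<mu> z) = (\<integral>\<^sup>+x. \<integral>\<^sup>+u. f (x, Q (z, x) u) \<partial>lambda01 \<partial>\<mu> z)"
      unfolding \<kappa>_def by (intro nn_integral_cong nn_integral_distr) measurable
    also have "\<dots> = (\<integral>\<^sup>+p. f (fst p, Q (z, fst p) (snd p)) \<partial>(\<mu> z \<Otimes>\<^sub>M lambda01))"
      by (subst lam.nn_integral_fst[symmetric]) (auto simp: split_beta')
    also have "\<dots> = (\<integral>\<^sup>+p. f p \<partial>N)"
      unfolding N_def by (subst nn_integral_distr) (auto simp: split_beta')
    also have "\<dots> = (\<integral>\<^sup>+p. f p \<partial>\<pi> z)"
      unfolding \<open>N = \<pi> z\<close> ..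
    finally show "(\<integral>\<^sup>+x. \<integral>\<^sup>+y. f (x, y) \<partial>\<kappa> (z, x) \<partial>distr (\<pi> z) borel fst) = (\<integral>\<^sup>+p. f p \<partial>\<pi> z)"
      unfolding \<mu>_def .
  qed
qed

text \<open>Both coordinates are moved into the line by Borel embeddings, where the real case
  applies; the conditional laws come back along the retraction of the second coordinate.\<close>

lemma disintegration:
  fixes \<pi> :: "'z \<Rightarrow> ('x::{complete_space, second_countable_topology} \<times> 'y::{complete_space, second_countable_topology}) measure"
  assumes \<pi> [measurable]: "\<pi> \<in> M \<rightarrow>\<^sub>M prob_algebra (borel \<Otimes>\<^sub>M borel)"
  obtains \<kappa> :: "'z \<times> 'x \<Rightarrow> 'y measure"
  where "\<kappa> \<in> M \<Otimes>\<^sub>M borel \<rightarrow>\<^sub>M prob_algebra borel"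
    "\<And>z f. z \<in> space M \<Longrightarrow> f \<in> borel_measurable (borel \<Otimes>\<^sub>M borel) \<Longrightarrow>
      (\<integral>\<^sup>+x. \<integral>\<^sup>+y. f (x, y) \<partial>\<kappa> (z, x) \<partial>distr (\<pi> z) borel fst) = (\<integral>\<^sup>+p. f p \<partial>\<pi> z)"
proof -
  obtain eX :: "'x \<Rightarrow> real" and rX where X [measurable]: "eX \<in> borel \<rightarrow>\<^sub>M borel" "rX \<in> borel \<rightarrow>\<^sub>M borel"
    and rX: "\<And>x. rX (eX x) = x"
    using polish_space_borel_retract_of_real by metis
  obtain eY :: "'y \<Rightarrow> real" and rY where Y [measurable]: "eY \<in> borel \<rightarrow>\<^sub>M borel" "rY \<in> borel \<rightarrow>\<^sub>M borel"
    and rY: "\<And>y. rY (eY y) = y" and eY: "\<And>y. eY y \<in> {0..1}"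
    using polish_space_borel_retract_of_real by (metis rangeI subsetD)
  define \<pi>' where "\<pi>' z = distr (\<pi> z) (borel \<Otimes>\<^sub>M borel) (\<lambda>p. (eX (fst p), eY (snd p)))" for z
  have \<pi>'_meas: "\<pi>' \<in> M \<rightarrow>\<^sub>M prob_algebra (borel \<Otimes>\<^sub>M borel)"
    unfolding \<pi>'_def by measurable
  have supp: "AE p in \<pi>' z. snd p \<in> {0..1}" if z: "z \<in> space M" for z
  proof -
    note [measurable_cong] = kernel_prob(2)[OF \<pi> z]
    show ?thesis
      unfolding \<pi>'_def using eY by (subst AE_distr_iff) auto
  qed
  obtain \<kappa>' :: "'z \<times> real \<Rightarrow> real measure" where \<kappa>' [measurable]: "\<kappa>' \<in> M \<Otimes>\<^sub>M borel \<rightarrow>\<^sub>M prob_algebra borel"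
    and dis: "\<And>z f. z \<in> space M \<Longrightarrow> f \<in> borel_measurable (borel \<Otimes>\<^sub>M borel) \<Longrightarrow>
      (\<integral>\<^sup>+x. \<integral>\<^sup>+y. f (x, y) \<partial>\<kappa>' (z, x) \<partial>distr (\<pi>' z) borel fst) = (\<integral>\<^sup>+p. f p \<partial>\<pi>' z)"
    using disintegration_real[OF \<pi>'_meas supp] by blast
  \<comment> \<open>\<open>rY\<close> is defined on the whole line, so this is a probability measure
    even if the real conditional law charges points off the range of \<open>eY\<close>.\<close>
  define \<kappa> where "\<kappa> w = distr (\<kappa>' (fst w, eX (snd w))) borel rY" for w
  show thesis
  proof (rule that)
    show "\<kappa> \<in> M \<Otimes>\<^sub>M borel \<rightarrow>\<^sub>M prob_algebra borel"
      unfolding \<kappa>_def by measurable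
    fix z and f :: "'x \<times> 'y \<Rightarrow> ennreal"
    assume z: "z \<in> space M" and f [measurable]: "f \<in> borel_measurable (borel \<Otimes>\<^sub>M borel)"
    note [measurable_cong] = kernel_prob(2)[OF \<pi> z]
    let ?f = "\<lambda>p. f (rX (fst p), rY (snd p))"
    have sets_k: "sets (\<kappa>' (z, s)) = sets borel" for s
      using z by (intro kernel_prob(2)[OF \<kappa>']) (simp add: space_pair_measure)
    have k_meas [measurable]: "(\<lambda>s. \<kappa>' (z, s)) \<in> borel \<rightarrow>\<^sub>M subprob_algebra borel"
      using z by (intro measurable_prob_algebraD) measurable
    have inner [measurable]: "(\<lambda>s. \<integral>\<^sup>+t. ?f (s, t) \<partial>\<kappa>' (z, s)) \<in> borel_measurable borel"
      by (rule nn_integral_measurable_subprob_algebra2[OF _ k_meas]) measurable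
    have "(\<integral>\<^sup>+x. \<integral>\<^sup>+y. f (x, y) \<partial>\<kappa> (z, x) \<partial>distr (\<pi> z) borel fst)
        = (\<integral>\<^sup>+x. \<integral>\<^sup>+t. ?f (eX x, t) \<partial>\<kappa>' (z, eX x) \<partial>distr (\<pi> z) borel fst)"
      unfolding \<kappa>_def fst_conv snd_conv rX
      by (intro nn_integral_cong nn_integral_distr) (simp_all add: measurable_cong_sets[OF sets_k refl])
    also have "\<dots> = (\<integral>\<^sup>+p. \<integral>\<^sup>+t. ?f (eX (fst p), t) \<partial>\<kappa>' (z, eX (fst p)) \<partial>\<pi> z)"
      by (rule nn_integral_distr) (use measurable_compose[OF X(1) inner] in simp_all)
    also have "\<dots> = (\<integral>\<^sup>+p. \<integral>\<^sup>+t. ?f (fst p, t) \<partial>\<kappa>' (z, fst p) \<partial>\<pi>' z)"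
      unfolding \<pi>'_def
      by (subst nn_integral_distr) (use measurable_compose[OF measurable_fst inner] in simp_all)
    also have "\<dots> = (\<integral>\<^sup>+s. \<integral>\<^sup>+t. ?f (s, t) \<partial>\<kappa>' (z, s) \<partial>distr (\<pi>' z) borel fst)"
      by (rule nn_integral_distr[symmetric])
         (use inner in \<open>simp_all add: \<pi>'_def measurable_cong_sets[OF sets_distr refl]\<close>)
    also have "\<dots> = (\<integral>\<^sup>+p. ?f p \<partial>\<pi>' z)"
      by (rule dis[OF z]) measurable
    also have "\<dots> = (\<integral>\<^sup>+p. f p \<partial>\<pi> z)"
      unfolding \<pi>'_def by (subst nn_integral_distr) (auto simp: rX rY)
    finally show "(\<integral>\<^sup>+x. \<integral>\<^sup>+y. f (x, y) \<partial>\<kappa> (z, x) \<partial>distr (\<pi> z) borel fst) = (\<integral>\<^sup>+p. f p \<partial>\<pi> z)" .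
  qed
qed

section \<open>Fibrewise isomorphisms onto a product with the unit interval\<close>

text \<open>The survival function of a probability measure is right-continuous, so the right limit
  that the quantile produces is its value at t.\<close>

lemma distr_quantile:
  assumes "prob_space N" and sets_N [measurable_cong]: "sets N = sets borel" and supp: "AE x in N. x \<in> {0..1}"
  shows "quantile (\<lambda>t. measure N {t<..}) \<in> I01 \<rightarrow>\<^sub>M borel"
    and "distr lambda01 borel (quantile (\<lambda>t. measure N {t<..})) = N"
proof -
  interpret prob_space N by fact
  interpret lam: prob_space lambda01 by (rule prob_space_lambda01)
  let ?h = "\<lambda>t. measure N {t<..}"
  have sp: "space N = UNIV" using sets_eq_imp_space_eq[OF sets_N] by simp
  \<comment> \<open>A dummy parameter makes the jointly measurable version applicable.\<close>
  have "(\<lambda>(w::unit, u). quantile ?h u) \<in> count_space UNIV \<Otimes>\<^sub>M I01 \<rightarrow>\<^sub>M borel"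
    by (rule measurable_quantile_I01) simp
  from measurable_Pair2[OF this, of "()"] show Q_meas: "quantile ?h \<in> I01 \<rightarrow>\<^sub>M borel" by simp
  then have Q_meas' [measurable]: "quantile ?h \<in> lambda01 \<rightarrow>\<^sub>M borel"
    by (simp add: measurable_cong_sets[OF sets_lambda01 refl])
  show "distr lambda01 borel (quantile ?h) = N"
  proof (rule measure_eqI_lessThan)
    fix t :: real
    have D: "emeasure (distr lambda01 borel (quantile ?h)) {t<..} = emeasure lambda01 {u \<in> {0..1}. t < quantile ?h u}"
      by (subst emeasure_distr) (auto intro!: arg_cong[where f="emeasure lambda01"])
    show "emeasure (distr lambda01 borel (quantile ?h)) {t<..} < \<infinity>"
      unfolding D by (simp add: less_top[symmetric])
    consider "t < 0" | "1 \<le> t" | "0 \<le> t" "t < 1" by linarith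
    then show "emeasure (distr lambda01 borel (quantile ?h)) {t<..} = emeasure N {t<..}"
    proof cases
      case 1
      then have "{u \<in> {0..1}. t < quantile ?h u} = {0..1}"
        using quantile_bounds(1)[of ?h] by (auto intro: less_le_trans)
      moreover have "emeasure N {t<..} = emeasure N (space N)"
        using supp 1 by (intro emeasure_eq_AE) (auto simp: sets_N sp)
      ultimately show ?thesis
        unfolding D using lam.emeasure_space_1 emeasure_space_1 by simp
    next
      case 2
      then have "{u \<in> {0..1}. t < quantile ?h u} = {}"
        using quantile_bounds(2)[of ?h] by (auto dest: le_less_trans less_le_trans simp: not_less intro: order_trans)
      moreover have "emeasure N {t<..} = emeasure N {}"
        using supp 2 by (intro emeasure_eq_AE) (auto simp: sets_N)
      ultimately show ?thesis unfolding D by (simp only: emeasure_empty)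
    next
      case 3
      obtain q :: "nat \<Rightarrow> real"
        where q: "decseq q" "\<And>k. q k \<in> \<rat> \<inter> {0..1}" "\<And>k. t < q k" "q \<longlonglongrightarrow> t"
        using rational_sequence_from_above[OF 3] by blast
      have "emeasure lambda01 {u \<in> {0..1}. t < quantile ?h u} = (SUP k. ennreal (?h (q k)))"
        by (rule emeasure_quantile_greater[OF _ _ _ 3(1) q])
           (auto intro!: finite_measure_mono simp: sets_N)
      also have "\<dots> = (SUP k. emeasure N {q k<..})"
        by (simp add: emeasure_eq_measure)
      also have "\<dots> = emeasure N (\<Union>k. {q k<..})"
        using decseq_SucD[OF q(1)]
        by (intro SUP_emeasure_incseq incseq_SucI) (auto simp: sets_N intro: le_less_trans)
      also have "(\<Union>k. {q k<..}) = {t<..}"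
      proof safe
        fix x assume "t < x"
        have "eventually (\<lambda>k. q k < x) sequentially"
          using q(4) \<open>t < x\<close> by (rule order_tendstoD)
        then show "x \<in> (\<Union>k. {q k<..})" by (auto simp: eventually_sequentially)
      qed (use q(3) in \<open>auto intro: less_trans\<close>)
      finally show ?thesis unfolding D .
    qed
  qed (auto simp: sets_N)
qed

text \<open>On an atomless law the quantile function is strictly monotone, since a level interval
  \<open>[u, v]\<close> would produce an atom of mass \<open>v - u\<close>; hence the survival function inverts it.\<close>
lemma survival_quantile:
  assumes "prob_space N" and sets_N [measurable_cong]: "sets N = sets borel" and supp: "AE x in N. x \<in> {0..1}"
    and atomless: "\<And>t. emeasure N {t} = 0" and u: "u \<in> {0..1}"
  shows "measure N {quantile (\<lambda>t. measure N {t<..}) u<..} = u"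
proof -
  interpret prob_space N by fact
  let ?Q = "quantile (\<lambda>t. measure N {t<..})"
  have [measurable]: "?Q \<in> lambda01 \<rightarrow>\<^sub>M borel"
    using distr_quantile(1)[OF assms(1-3)] by (simp add: measurable_cong_sets[OF sets_lambda01 refl])
  have N: "emeasure N A = emeasure lambda01 (?Q -` A \<inter> {0..1})" if "A \<in> sets borel" for A
    using that by (subst distr_quantile(2)[OF assms(1-3), symmetric], subst emeasure_distr) auto
  have strict: "?Q w < ?Q v" if "v < w" "0 \<le> v" "w \<le> 1" for v w
  proof (rule ccontr)
    assume "\<not> ?Q w < ?Q v"
    then have eq: "?Q w = ?Q v"
      using quantile_antimono[of v w] \<open>v < w\<close> by (simp add: order_antisym)
    have "{v..w} \<subseteq> ?Q -` {?Q v} \<inter> {0..1}"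
    proof
      fix x assume "x \<in> {v..w}"
      then have "?Q x \<le> ?Q v" "?Q w \<le> ?Q x" by (auto intro: quantile_antimono)
      with eq \<open>x \<in> {v..w}\<close> that show "x \<in> ?Q -` {?Q v} \<inter> {0..1}" by auto
    qed
    moreover have "?Q -` {?Q v} \<inter> {0..1} \<in> sets lambda01"
      using measurable_sets[of ?Q lambda01 borel "{?Q v}"] by simp
    ultimately have "emeasure lambda01 {v..w} \<le> emeasure N {?Q v}"
      unfolding N[OF borel_singleton[OF sets.empty_sets]] by (rule emeasure_mono)
    then have "emeasure lborel {v..w} = 0"
      using that by (simp add: atomless emeasure_lambda01)
    with \<open>v < w\<close> show False by simp
  qed
  \<comment> \<open>By strict monotonicity the quantile exceeds its value at u exactly for arguments
    below u, a set of length u.\<close>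
  have "?Q -` {?Q u<..} \<inter> {0..1} = {0..<u}"
  proof (intro set_eqI iffI)
    fix x assume "x \<in> ?Q -` {?Q u<..} \<inter> {0..1}"
    then have x: "?Q u < ?Q x" "x \<in> {0..1}" by auto
    then have "\<not> u \<le> x" using quantile_antimono[of u x] by (auto simp: not_le[symmetric])
    with x show "x \<in> {0..<u}" by auto
  next
    fix x assume "x \<in> {0..<u}"
    then show "x \<in> ?Q -` {?Q u<..} \<inter> {0..1}" using u strict[of x u] by auto
  qed
  then have "emeasure N {?Q u<..} = emeasure lambda01 {0..<u}"
    by (subst N) auto
  also have "\<dots> = ennreal u"
    using u by (subst emeasure_lambda01) auto
  finally show ?thesis
    using u by (simp add: emeasure_eq_measure)
qed

section \<open>Isomorphisms from the interval, measurable in a parameter\<close>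

lemma measurable_into_times_I01:
  assumes "f \<in> M \<rightarrow>\<^sub>M borel \<Otimes>\<^sub>M borel" "\<And>x. x \<in> space M \<Longrightarrow> snd (f x) \<in> {0..1}"
  shows "f \<in> M \<rightarrow>\<^sub>M borel \<Otimes>\<^sub>M I01"
  using assms
  by (intro measurable_pair measurable_into_I01) (auto simp: comp_def)

lemma measurable_times_I01_borel:
  fixes f :: "'a::second_countable_topology \<times> real \<Rightarrow> 'b::topological_space"
  assumes "f \<in> borel_measurable borel"
  shows "f \<in> borel \<Otimes>\<^sub>M I01 \<rightarrow>\<^sub>M borel"
proof -
  have "(\<lambda>p. (fst p, snd p)) \<in> (borel :: 'a measure) \<Otimes>\<^sub>M I01 \<rightarrow>\<^sub>M borel \<Otimes>\<^sub>M borel"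
    by (intro measurable_Pair measurable_fst measurable_snd_I01)
  moreover have "f \<in> borel \<Otimes>\<^sub>M borel \<rightarrow>\<^sub>M borel"
    using assms by (simp add: borel_prod)
  ultimately show ?thesis
    using measurable_compose[of "\<lambda>p. (fst p, snd p)" "borel \<Otimes>\<^sub>M I01" "borel \<Otimes>\<^sub>M borel" f borel] by simp
qed

text \<open>Schroeder-Bernstein is applied once, to the total spaces over \<open>W\<close>, with
  maps that fix the \<open>W\<close>-coordinate. This yields isomorphisms of all fibres at once,
  measurably in w.\<close>

lemma kernel_times_lambda01_iso:
  fixes \<kappa> :: "'w \<Rightarrow> 'y::{complete_space, second_countable_topology} measure"
  assumes \<kappa> [measurable]: "\<kappa> \<in> W \<rightarrow>\<^sub>M prob_algebra borel"
  obtains A B where "A \<in> W \<Otimes>\<^sub>M I01 \<rightarrow>\<^sub>M borel \<Otimes>\<^sub>M I01" "B \<in> W \<Otimes>\<^sub>M (borel \<Otimes>\<^sub>M I01) \<rightarrow>\<^sub>M I01"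
    "\<And>w u. w \<in> space W \<Longrightarrow> u \<in> {0..1} \<Longrightarrow> B (w, A (w, u)) = u"
    "\<And>w p. w \<in> space W \<Longrightarrow> snd p \<in> {0..1} \<Longrightarrow> A (w, B (w, p)) = p"
    "\<And>w. w \<in> space W \<Longrightarrow> distr lambda01 (borel \<Otimes>\<^sub>M I01) (\<lambda>u. A (w, u)) = \<kappa> w \<Otimes>\<^sub>M lambda01"
proof -
  let ?P = "(borel :: 'y measure) \<Otimes>\<^sub>M I01"
  obtain e :: "'y \<times> real \<Rightarrow> real" and r where e_borel: "e \<in> borel \<rightarrow>\<^sub>M borel"
    and r_borel: "r \<in> borel \<rightarrow>\<^sub>M borel" and re: "\<And>p. r (e p) = p"
    and e01: "\<And>p. e p \<in> {0..1}" and e_null: "range e \<in> null_sets lborel"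
    using polish_space_borel_retract_of_real[where 'a="'y \<times> real"] by (metis rangeI subsetD)
  \<comment> \<open>A second null embedding: Y \<times> C is a negligible part of the target with
    room for an injective copy of the whole interval.\<close>
  obtain c d :: "real \<Rightarrow> real" where c [measurable]: "c \<in> borel \<rightarrow>\<^sub>M borel"
    and d [measurable]: "d \<in> borel \<rightarrow>\<^sub>M borel" and dc: "\<And>p. d (c p) = p"
    and c01: "\<And>p. c p \<in> {0..1}" and c_null: "range c \<in> null_sets lborel"
    using polish_space_borel_retract_of_real[where 'a=real] by (metis rangeI subsetD)
  define C where "C = range c"
  have C [measurable]: "C \<in> sets borel" using c_null by (auto simp: C_def null_sets_def)
  have space_P: "space ?P = UNIV \<times> {0..1}" by (simp add: space_pair_measure)
  have e_P [measurable]: "e \<in> ?P \<rightarrow>\<^sub>M borel" by (rule measurable_times_I01_borel[OF e_borel])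
  have e_I [measurable]: "e \<in> ?P \<rightarrow>\<^sub>M I01" using e_P e01 by (intro measurable_into_I01) auto
  have r_pair [measurable]: "r \<in> borel \<rightarrow>\<^sub>M borel \<Otimes>\<^sub>M borel" using r_borel by (simp add: borel_prod)
  \<comment> \<open>The default point has second coordinate 0, so \<open>r'\<close> lands in Y
    \<times> [0,1] everywhere.\<close>
  define r' where "r' t = (if snd (r t) \<in> {0..1} then r t else (undefined, 0))" for t
  have r' [measurable]: "r' \<in> borel \<rightarrow>\<^sub>M ?P"
  proof (rule measurable_into_times_I01)
    show "r' \<in> borel \<rightarrow>\<^sub>M borel \<Otimes>\<^sub>M borel" unfolding r'_def by measurable
  qed (auto simp: r'_def)
  have r'_I [measurable]: "r' \<in> I01 \<rightarrow>\<^sub>M ?P" by (rule measurable_I01_borel) fact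
  have r'e: "r' (e p) = p" if "snd p \<in> {0..1}" for p using that by (simp add: r'_def re)
  define m where "m w = distr (\<kappa> w \<Otimes>\<^sub>M lambda01) borel e" for w
  have m_meas [measurable]: "m \<in> W \<rightarrow>\<^sub>M prob_algebra borel"
    unfolding m_def
  proof (rule measurable_compose[OF _ measurable_distr_prob_space[OF e_P]])
    show "(\<lambda>w. \<kappa> w \<Otimes>\<^sub>M lambda01) \<in> W \<rightarrow>\<^sub>M prob_algebra ?P" by measurable
  qed
  define S where "S w t = measure (m w) {t<..}" for w t
  have S_joint [measurable]: "(\<lambda>x. S (fst x) (snd x)) \<in> borel_measurable (W \<Otimes>\<^sub>M borel)"
    unfolding S_def
  proof (rule measure_measurable_subprob_algebra2)
    show "(\<lambda>x. m (fst x)) \<in> W \<Otimes>\<^sub>M borel \<rightarrow>\<^sub>M subprob_algebra borel"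
      by (rule measurable_prob_algebraD) measurable
    have "(SIGMA x:space (W \<Otimes>\<^sub>M borel). {snd x<..})
        = {p \<in> space ((W \<Otimes>\<^sub>M borel) \<Otimes>\<^sub>M (borel :: real measure)). snd (fst p) < snd p}"
      by (auto simp: space_pair_measure)
    also have "\<dots> \<in> sets ((W \<Otimes>\<^sub>M borel) \<Otimes>\<^sub>M borel)" by measurable
    finally show "(SIGMA x:space (W \<Otimes>\<^sub>M borel). {snd x<..}) \<in> sets ((W \<Otimes>\<^sub>M borel) \<Otimes>\<^sub>M (borel :: real measure))" .
  qed
  define Q where "Q a = quantile (S (fst a)) (snd a)" for a
  have Q_meas [measurable]: "Q \<in> W \<Otimes>\<^sub>M I01 \<rightarrow>\<^sub>M borel"
  proof -
    have "(\<lambda>(w, u). quantile (S w) u) \<in> W \<Otimes>\<^sub>M I01 \<rightarrow>\<^sub>M borel"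
    proof (rule measurable_quantile_I01)
      show "(\<lambda>w. S w q) \<in> borel_measurable W" for q
        using measurable_compose[OF _ S_joint, of "\<lambda>w. (w, q)" W] by simp
    qed
    then show ?thesis by (simp add: Q_def[abs_def] split_beta')
  qed
  \<comment> \<open>Good points are those in the image of Y \<times> [0,1] under \<open>e\<close>
    that decode outside the reserved part Y \<times> C.\<close>
  define good where "good t \<longleftrightarrow> e (r' t) = t \<and> snd (r' t) \<notin> C" for t
  have snd_r' [measurable]: "(\<lambda>t. snd (r' t)) \<in> borel_measurable borel"
    using measurable_compose[OF r' measurable_snd_I01] .
  have good_meas [measurable]: "Measurable.pred borel good"
    unfolding good_def by measurable
  text \<open>\<open>r' \<circ> Q\<close> transports \<open>\<lambda>\<close> to \<open>\<kappa> w \<otimes> \<lambda>\<close>; to keep it injective, the null set of \<open>u\<close>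
    on which it leaves the range of \<open>e\<close> or meets \<open>Y \<times> C\<close> is rerouted into \<open>Y \<times> C\<close>.\<close>
  define F where "F a = (if good (Q a) then r' (Q a) else (undefined, c (snd a)))" for a
  have F_meas [measurable]: "F \<in> W \<Otimes>\<^sub>M I01 \<rightarrow>\<^sub>M ?P"
  proof -
    have "(\<lambda>a. c (snd a)) \<in> W \<Otimes>\<^sub>M I01 \<rightarrow>\<^sub>M I01"
      using c01 measurable_compose[OF measurable_snd_I01 c] by (intro measurable_into_I01) auto
    then show ?thesis unfolding F_def by measurable
  qed
  \<comment> \<open>Whether the second coordinate lies in \<open>C\<close> tells which branch of
    \<open>F\<close> was taken: there \<open>d\<close> undoes \<open>c\<close>, elsewhere the
    survival function undoes the quantile. The clamp handles points of \<open>C\<close> that code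
    reals outside [0,1].\<close>
  define L where "L b = (if snd (snd b) \<in> C then max 0 (min 1 (d (snd (snd b)))) else S (fst b) (e (snd b)))" for b
  have snd_snd [measurable]: "(\<lambda>b. snd (snd b)) \<in> borel_measurable (W \<Otimes>\<^sub>M ?P)"
    using measurable_compose[OF measurable_snd measurable_snd_I01] .
  have m_props: "prob_space (m w)" "sets (m w) = sets borel" "AE x in m w. x \<in> {0..1}" "\<And>t. emeasure (m w) {t} = 0"
    "AE t in m w. good t" "distr (m w) ?P r' = \<kappa> w \<Otimes>\<^sub>M lambda01"
    if w: "w \<in> space W" for w
  proof -
    interpret k: prob_space "\<kappa> w" by (rule kernel_prob(1)[OF \<kappa> w])
    interpret lam: prob_space lambda01 by (rule prob_space_lambda01)
    interpret kl: pair_prob_space "\<kappa> w" lambda01 ..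
    note sets_k [measurable_cong] = kernel_prob(2)[OF \<kappa> w]
    have sets_kl [measurable_cong]: "sets (\<kappa> w \<Otimes>\<^sub>M lambda01) = sets ?P"
      by (intro sets_pair_measure_cong sets_k sets_lambda01)
    have space_kl: "space (\<kappa> w \<Otimes>\<^sub>M lambda01) = UNIV \<times> {0..1}"
      using sets_eq_imp_space_eq[OF sets_kl] space_P by simp
    have e_kl: "e \<in> \<kappa> w \<Otimes>\<^sub>M lambda01 \<rightarrow>\<^sub>M borel" by measurable
    show "prob_space (m w)" "sets (m w) = sets borel"
      by (rule kernel_prob[OF m_meas w])+
    show "AE x in m w. x \<in> {0..1}"
      unfolding m_def using e01 by (subst AE_distr_iff[OF e_kl]) auto
    show "emeasure (m w) {t} = 0" for t
    proof -
      \<comment> \<open>Only \<open>r t\<close> can be mapped to t by \<open>e\<close>, and a single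
        point of the interval has length 0; hence \<open>m w\<close> has no atoms.\<close>
      have null: "emeasure (\<kappa> w \<Otimes>\<^sub>M lambda01) ({fst (r t)} \<times> ({snd (r t)} \<inter> {0..1})) = 0"
      proof -
        have "emeasure lambda01 ({snd (r t)} \<inter> {0..1}) = 0"
          by (subst emeasure_lambda01) (auto intro!: emeasure_lborel_countable)
        then show ?thesis
          by (subst lam.emeasure_pair_measure_Times) (auto simp: sets_k sets_lambda01 sets_I01_subset_borel)
      qed
      have "emeasure (m w) {t} = emeasure (\<kappa> w \<Otimes>\<^sub>M lambda01) (e -` {t} \<inter> space (\<kappa> w \<Otimes>\<^sub>M lambda01))"
        unfolding m_def by (rule emeasure_distr[OF e_kl]) simp
      also have "\<dots> \<le> emeasure (\<kappa> w \<Otimes>\<^sub>M lambda01) ({fst (r t)} \<times> ({snd (r t)} \<inter> {0..1}))"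
        by (rule emeasure_mono) (auto simp: re space_kl sets_kl sets_I01_subset_borel)
      finally show ?thesis using null by simp
    qed
    have "AE u in lambda01. u \<notin> C"
    proof (rule AE_I)
      show "emeasure lambda01 (C \<inter> {0..1}) = 0"
        using c_null c01 by (subst emeasure_lambda01) (auto simp: C_def Int_absorb2 image_subset_iff)
    qed (auto simp: sets_lambda01 sets_I01_subset_borel)
    then have "AE p in \<kappa> w \<Otimes>\<^sub>M lambda01. snd p \<notin> C"
    proof (intro kl.AE_pair_measure)
      have "{p \<in> space ?P. snd p \<notin> C} \<in> sets ?P"
        using measurable_snd_I01[of borel] by measurable
      then show "{x \<in> space (\<kappa> w \<Otimes>\<^sub>M lambda01). snd x \<notin> C} \<in> sets (\<kappa> w \<Otimes>\<^sub>M lambda01)"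
        by (simp add: sets_kl space_kl space_P)
    qed simp
    with AE_space have "AE p in \<kappa> w \<Otimes>\<^sub>M lambda01. good (e p)"
      by eventually_elim (auto simp: good_def r'e space_kl)
    then show "AE t in m w. good t"
      unfolding m_def by (subst AE_distr_iff[OF e_kl]) auto
    have "distr (m w) ?P r' = distr (\<kappa> w \<Otimes>\<^sub>M lambda01) ?P (r' \<circ> e)"
      unfolding m_def by (rule distr_distr[OF r' e_kl])
    also have "\<dots> = distr (\<kappa> w \<Otimes>\<^sub>M lambda01) (\<kappa> w \<Otimes>\<^sub>M lambda01) (\<lambda>p. p)"
      by (rule distr_cong) (auto simp: sets_kl space_kl r'e)
    also have "\<dots> = \<kappa> w \<Otimes>\<^sub>M lambda01" by (rule distr_id)
    finally show "distr (m w) ?P r' = \<kappa> w \<Otimes>\<^sub>M lambda01" .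
  qed
  have L_meas [measurable]: "L \<in> W \<Otimes>\<^sub>M ?P \<rightarrow>\<^sub>M I01"
  proof (rule measurable_into_I01)
    have "(\<lambda>b. S (fst b) (e (snd b))) \<in> borel_measurable (W \<Otimes>\<^sub>M ?P)"
      using measurable_compose[OF _ S_joint, of "\<lambda>b. (fst b, e (snd b))" "W \<Otimes>\<^sub>M ?P"] by simp
    then show "L \<in> borel_measurable (W \<Otimes>\<^sub>M ?P)"
      unfolding L_def by measurable
    show "L b \<in> {0..1}" if "b \<in> space (W \<Otimes>\<^sub>M ?P)" for b
    proof -
      have "prob_space (m (fst b))" using that by (intro m_props) (auto simp: space_pair_measure)
      then show ?thesis by (auto simp: L_def S_def prob_space.prob_le_1)
    qed
  qed
  have S_Q: "S w (Q (w, u)) = u" if "w \<in> space W" "u \<in> {0..1}" for w u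
    using survival_quantile[OF m_props(1-4)[OF that(1)] that(2)] by (simp add: S_def[abs_def] Q_def)
  have L_F: "L (w, F (w, u)) = u" if "w \<in> space W" "u \<in> {0..1}" for w u
    using that S_Q[OF that] dc by (auto simp: L_def F_def good_def C_def)
  obtain h k where h [measurable]: "h \<in> W \<Otimes>\<^sub>M I01 \<rightarrow>\<^sub>M W \<Otimes>\<^sub>M ?P" and k [measurable]: "k \<in> W \<Otimes>\<^sub>M ?P \<rightarrow>\<^sub>M W \<Otimes>\<^sub>M I01"
    and kh: "\<And>a. a \<in> space (W \<Otimes>\<^sub>M I01) \<Longrightarrow> k (h a) = a" and hk: "\<And>b. b \<in> space (W \<Otimes>\<^sub>M ?P) \<Longrightarrow> h (k b) = b"
    and h_cases: "\<And>a. a \<in> space (W \<Otimes>\<^sub>M I01) \<Longrightarrow>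
      h a = (fst a, F a) \<or> ((fst a, e (r' (snd a))) = a \<and> h a = (fst a, r' (snd a)))"
  proof (rule borel_schroeder_bernstein[of "\<lambda>a. (fst a, F a)" "W \<Otimes>\<^sub>M I01" "W \<Otimes>\<^sub>M ?P" "\<lambda>b. (fst b, L b)"
        "\<lambda>b. (fst b, e (snd b))" "\<lambda>a. (fst a, r' (snd a))"])
    show "(\<lambda>a. (fst a, F a)) \<in> W \<Otimes>\<^sub>M I01 \<rightarrow>\<^sub>M W \<Otimes>\<^sub>M ?P" by measurable
    show "(\<lambda>b. (fst b, L b)) \<in> W \<Otimes>\<^sub>M ?P \<rightarrow>\<^sub>M W \<Otimes>\<^sub>M I01" by measurable
    show "(\<lambda>b. (fst b, e (snd b))) \<in> W \<Otimes>\<^sub>M ?P \<rightarrow>\<^sub>M W \<Otimes>\<^sub>M I01" by measurable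
    show "(\<lambda>a. (fst a, r' (snd a))) \<in> W \<Otimes>\<^sub>M I01 \<rightarrow>\<^sub>M W \<Otimes>\<^sub>M ?P" by measurable
    show "(fst (fst a, F a), L (fst a, F a)) = a" if "a \<in> space (W \<Otimes>\<^sub>M I01)" for a
      using that L_F by (cases a) (auto simp: space_pair_measure)
    show "(fst (fst b, e (snd b)), r' (snd (fst b, e (snd b)))) = b" if "b \<in> space (W \<Otimes>\<^sub>M ?P)" for b
      using that r'e by (cases b) (auto simp: space_pair_measure)
    have "(\<lambda>a. e (r' (snd a))) \<in> borel_measurable (W \<Otimes>\<^sub>M I01)" by measurable
    then have "{a \<in> space (W \<Otimes>\<^sub>M I01). e (r' (snd a)) = snd a} \<in> sets (W \<Otimes>\<^sub>M I01)"
      by (rule measurable_equality_set[OF _ measurable_snd_I01])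
    then show "{a \<in> space (W \<Otimes>\<^sub>M I01). (fst (fst a, r' (snd a)), e (snd (fst a, r' (snd a)))) = a} \<in> sets (W \<Otimes>\<^sub>M I01)"
      by (simp add: prod_eq_iff)
    \<comment> \<open>Equality sets are measurable for maps into \<open>borel\<close>, so maps into
      the product with \<open>I01\<close> are first regarded as Borel-valued.\<close>
    have id_P: "(\<lambda>p. p) \<in> ?P \<rightarrow>\<^sub>M borel" by (rule measurable_times_I01_borel) simp
    have "(\<lambda>b. F (fst b, L b)) \<in> W \<Otimes>\<^sub>M ?P \<rightarrow>\<^sub>M ?P" by measurable
    from measurable_compose[OF this id_P] measurable_compose[OF measurable_snd id_P, of W]
    have "{b \<in> space (W \<Otimes>\<^sub>M ?P). F (fst b, L b) = snd b} \<in> sets (W \<Otimes>\<^sub>M ?P)"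
      by (rule measurable_equality_set)
    then show "{b \<in> space (W \<Otimes>\<^sub>M ?P). (fst (fst b, L b), F (fst b, L b)) = b} \<in> sets (W \<Otimes>\<^sub>M ?P)"
      by (simp add: prod_eq_iff)
  qed (auto simp: prod_eq_iff)
  \<comment> \<open>Both alternatives for \<open>h\<close> keep the parameter, so \<open>h\<close>
    and its inverse act fibre by fibre.\<close>
  have fst_h: "fst (h a) = fst a" if "a \<in> space (W \<Otimes>\<^sub>M I01)" for a
    using h_cases[OF that] by auto
  have fst_k: "fst (k b) = fst b" if "b \<in> space (W \<Otimes>\<^sub>M ?P)" for b
    using fst_h[OF measurable_space[OF k that]] hk[OF that] by simp
  show thesis
  proof
    show A_meas: "(\<lambda>a. snd (h a)) \<in> W \<Otimes>\<^sub>M I01 \<rightarrow>\<^sub>M ?P" by measurable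
    show "(\<lambda>b. snd (k b)) \<in> W \<Otimes>\<^sub>M ?P \<rightarrow>\<^sub>M I01" by measurable
    fix w assume w: "w \<in> space W"
    show "snd (k (w, snd (h (w, u)))) = u" if "u \<in> {0..1}" for u
    proof -
      have *: "(w, u) \<in> space (W \<Otimes>\<^sub>M I01)" using w that by (simp add: space_pair_measure)
      have "(w, snd (h (w, u))) = h (w, u)" using fst_h[OF *] by (simp add: prod_eq_iff)
      then show ?thesis using kh[OF *] by simp
    qed
    show "snd (h (w, snd (k (w, p)))) = p" if "snd p \<in> {0..1}" for p
    proof -
      have *: "(w, p) \<in> space (W \<Otimes>\<^sub>M ?P)" using w that by (cases p) (simp add: space_pair_measure)
      have "(w, snd (k (w, p))) = k (w, p)" using fst_k[OF *] by (simp add: prod_eq_iff)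
      then show ?thesis using hk[OF *] by simp
    qed
    have Qw: "(\<lambda>u. Q (w, u)) = quantile (\<lambda>t. measure (m w) {t<..})"
      by (simp add: Q_def S_def[abs_def])
    have Qw_meas: "(\<lambda>u. Q (w, u)) \<in> lambda01 \<rightarrow>\<^sub>M borel"
      using distr_quantile(1)[OF m_props(1-3)[OF w]] unfolding Qw
      by (simp add: measurable_cong_sets[OF sets_lambda01 refl])
    have Q_distr: "distr lambda01 borel (\<lambda>u. Q (w, u)) = m w"
      unfolding Qw by (rule distr_quantile(2)[OF m_props(1-3)[OF w]])
    have "AE u in lambda01. good (Q (w, u))"
      using m_props(5)[OF w] unfolding Q_distr[symmetric] by (subst (asm) AE_distr_iff[OF Qw_meas]) auto
    \<comment> \<open>\<open>h\<close> can depart from \<open>F\<close> only where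
      \<open>e (r' u) = u\<close>, that is, inside the null set \<open>range e\<close>.\<close>
    moreover have "AE u in lambda01. u \<notin> range e"
    proof (rule AE_I)
      show "emeasure lambda01 (range e) = 0"
        using e_null e01 by (subst emeasure_lambda01) auto
      show "range e \<in> sets lambda01"
        using e_null e01 by (auto simp: sets_lambda01 sets_I01_subset_borel null_sets_def)
    qed auto
    ultimately have AE_eq: "AE u in lambda01. snd (h (w, u)) = r' (Q (w, u))"
      using AE_space
    proof eventually_elim
      case (elim u)
      then have "(w, u) \<in> space (W \<Otimes>\<^sub>M I01)" using w by (simp add: space_pair_measure)
      moreover have "e (r' u) \<noteq> u" using elim by (metis rangeI)
      ultimately show ?case using h_cases[of "(w, u)"] elim by (auto simp: F_def)
    qed
    have A_w: "(\<lambda>u. snd (h (w, u))) \<in> lambda01 \<rightarrow>\<^sub>M ?P"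
      using measurable_Pair2[OF A_meas w] by (simp add: measurable_cong_sets[OF sets_lambda01 refl])
    have "distr lambda01 ?P (\<lambda>u. snd (h (w, u))) = distr lambda01 ?P (\<lambda>u. r' (Q (w, u)))"
      by (rule distr_cong_AE[OF refl refl AE_eq A_w measurable_compose[OF Qw_meas r']])
    also have "\<dots> = distr (m w) ?P r'"
      unfolding Q_distr[symmetric] by (subst distr_distr[OF r' Qw_meas]) (simp add: comp_def)
    also have "\<dots> = \<kappa> w \<Otimes>\<^sub>M lambda01" by (rule m_props(6)[OF w])
    finally show "distr lambda01 ?P (\<lambda>u. snd (h (w, u))) = \<kappa> w \<Otimes>\<^sub>M lambda01" .
  qed
qed

section \<open>The coupling theorem\<close>

text \<open>The fibrewise isomorphisms with pairs (z,x) as parameter and the conditional law of y as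
  kernel. The last clause says that (x,u) \<mapsto> (x, A((z,x),u)) carries \<mu> \<otimes>
  \<lambda> to \<pi> \<otimes> \<lambda>; integrals avoid reassociating the product.\<close>

lemma coupling_fibrewise_iso:
  fixes \<pi> :: "'z \<Rightarrow> ('x::{complete_space, second_countable_topology} \<times> 'y::{complete_space, second_countable_topology}) measure"
  assumes \<pi> [measurable]: "\<pi> \<in> M \<rightarrow>\<^sub>M prob_algebra (borel \<Otimes>\<^sub>M borel)"
  obtains A B where "A \<in> (M \<Otimes>\<^sub>M borel) \<Otimes>\<^sub>M I01 \<rightarrow>\<^sub>M borel \<Otimes>\<^sub>M I01"
    "B \<in> (M \<Otimes>\<^sub>M borel) \<Otimes>\<^sub>M (borel \<Otimes>\<^sub>M I01) \<rightarrow>\<^sub>M I01"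
    "\<And>z x u. z \<in> space M \<Longrightarrow> u \<in> {0..1} \<Longrightarrow> B ((z, x), A ((z, x), u)) = u"
    "\<And>z x p. z \<in> space M \<Longrightarrow> snd p \<in> {0..1} \<Longrightarrow> A ((z, x), B ((z, x), p)) = p"
    "\<And>z f. z \<in> space M \<Longrightarrow> f \<in> borel_measurable (borel \<Otimes>\<^sub>M (borel \<Otimes>\<^sub>M I01)) \<Longrightarrow>
      (\<integral>\<^sup>+q. f (fst q, A ((z, fst q), snd q)) \<partial>(distr (\<pi> z) borel fst \<Otimes>\<^sub>M lambda01))
        = (\<integral>\<^sup>+p. \<integral>\<^sup>+v. f (fst p, (snd p, v)) \<partial>lambda01 \<partial>\<pi> z)"
proof -
  obtain \<kappa> :: "'z \<times> 'x \<Rightarrow> 'y measure" where \<kappa> [measurable]: "\<kappa> \<in> M \<Otimes>\<^sub>M borel \<rightarrow>\<^sub>M prob_algebra borel"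
    and dis: "\<And>z f. z \<in> space M \<Longrightarrow> f \<in> borel_measurable (borel \<Otimes>\<^sub>M borel) \<Longrightarrow>
      (\<integral>\<^sup>+x. \<integral>\<^sup>+y. f (x, y) \<partial>\<kappa> (z, x) \<partial>distr (\<pi> z) borel fst) = (\<integral>\<^sup>+p. f p \<partial>\<pi> z)"
    using disintegration[OF \<pi>] by blast
  obtain A B where A [measurable]: "A \<in> (M \<Otimes>\<^sub>M borel) \<Otimes>\<^sub>M I01 \<rightarrow>\<^sub>M (borel :: 'y measure) \<Otimes>\<^sub>M I01"
    and B [measurable]: "B \<in> (M \<Otimes>\<^sub>M borel) \<Otimes>\<^sub>M (borel \<Otimes>\<^sub>M I01) \<rightarrow>\<^sub>M I01"
    and BA: "\<And>w u. w \<in> space (M \<Otimes>\<^sub>M borel) \<Longrightarrow> u \<in> {0..1} \<Longrightarrow> B (w, A (w, u)) = u"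
    and AB: "\<And>w p. w \<in> space (M \<Otimes>\<^sub>M borel) \<Longrightarrow> snd p \<in> {0..1} \<Longrightarrow> A (w, B (w, p)) = p"
    and distr_A: "\<And>w. w \<in> space (M \<Otimes>\<^sub>M borel) \<Longrightarrow>
      distr lambda01 (borel \<Otimes>\<^sub>M I01) (\<lambda>u. A (w, u)) = \<kappa> w \<Otimes>\<^sub>M lambda01"
    using kernel_times_lambda01_iso[OF \<kappa>] by blast
  show thesis
  proof (rule that[OF A B])
    show "B ((z, x), A ((z, x), u)) = u" if "z \<in> space M" "u \<in> {0..1}" for z x u
      using that by (intro BA) (auto simp: space_pair_measure)
    show "A ((z, x), B ((z, x), p)) = p" if "z \<in> space M" "snd p \<in> {0..1}" for z x p
      using that by (intro AB) (auto simp: space_pair_measure)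
    fix z and f :: "'x \<times> 'y \<times> real \<Rightarrow> ennreal"
    assume z: "z \<in> space M" and f [measurable]: "f \<in> borel_measurable (borel \<Otimes>\<^sub>M (borel \<Otimes>\<^sub>M I01))"
    let ?\<mu> = "distr (\<pi> z) borel fst"
    interpret lam: prob_space lambda01 by (rule prob_space_lambda01)
    have zx: "(z, x) \<in> space (M \<Otimes>\<^sub>M borel)" for x :: 'x
      using z by (simp add: space_pair_measure)
    have Az [measurable]: "(\<lambda>q. A ((z, fst q), snd q)) \<in> borel \<Otimes>\<^sub>M I01 \<rightarrow>\<^sub>M borel \<Otimes>\<^sub>M I01"
      using z by measurable
    have Ax: "(\<lambda>u. A ((z, x), u)) \<in> lambda01 \<rightarrow>\<^sub>M borel \<Otimes>\<^sub>M I01" for x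
      using measurable_Pair2[OF A zx] by (simp add: measurable_cong_sets[OF sets_lambda01 refl])
    have inner [measurable]: "(\<lambda>p. \<integral>\<^sup>+v. f (fst p, (snd p, v)) \<partial>lambda01) \<in> borel_measurable (borel \<Otimes>\<^sub>M borel)"
      by measurable
    have "(\<integral>\<^sup>+q. f (fst q, A ((z, fst q), snd q)) \<partial>(?\<mu> \<Otimes>\<^sub>M lambda01))
        = (\<integral>\<^sup>+x. \<integral>\<^sup>+u. f (x, A ((z, x), u)) \<partial>lambda01 \<partial>?\<mu>)"
      by (subst lam.nn_integral_fst[symmetric]) auto
    also have "\<dots> = (\<integral>\<^sup>+x. \<integral>\<^sup>+p. f (x, p) \<partial>(\<kappa> (z, x) \<Otimes>\<^sub>M lambda01) \<partial>?\<mu>)"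
      unfolding distr_A[OF zx, symmetric]
      by (intro nn_integral_cong nn_integral_distr[symmetric] Ax) measurable
    also have "\<dots> = (\<integral>\<^sup>+x. \<integral>\<^sup>+y. \<integral>\<^sup>+v. f (x, (y, v)) \<partial>lambda01 \<partial>\<kappa> (z, x) \<partial>?\<mu>)"
    proof (intro nn_integral_cong)
      fix x
      note [measurable_cong] = kernel_prob(2)[OF \<kappa> zx[of x]]
      show "(\<integral>\<^sup>+p. f (x, p) \<partial>(\<kappa> (z, x) \<Otimes>\<^sub>M lambda01)) = (\<integral>\<^sup>+y. \<integral>\<^sup>+v. f (x, (y, v)) \<partial>lambda01 \<partial>\<kappa> (z, x))"
        by (rule lam.nn_integral_fst[symmetric]) measurable
    qed
    also have "\<dots> = (\<integral>\<^sup>+p. \<integral>\<^sup>+v. f (fst p, (snd p, v)) \<partial>lambda01 \<partial>\<pi> z)"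
      using dis[OF z inner] by simp
    finally show "(\<integral>\<^sup>+q. f (fst q, A ((z, fst q), snd q)) \<partial>(?\<mu> \<Otimes>\<^sub>M lambda01))
        = (\<integral>\<^sup>+p. \<integral>\<^sup>+v. f (fst p, (snd p, v)) \<partial>lambda01 \<partial>\<pi> z)" .
  qed
qed

lemma emeasure_distr_nn_integral:
  assumes g: "g \<in> N \<rightarrow>\<^sub>M L" and D [measurable]: "D \<in> sets L"
  shows "emeasure (distr N L g) D = (\<integral>\<^sup>+x. indicator D (g x) \<partial>N)"
proof -
  have "emeasure (distr N L g) D = (\<integral>\<^sup>+y. indicator D y \<partial>distr N L g)"
    by simp
  also have "\<dots> = (\<integral>\<^sup>+x. indicator D (g x) \<partial>N)"
    by (rule nn_integral_distr[OF g]) simp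
  finally show ?thesis .
qed

theorem theorem2p3:
  fixes \<pi> :: "'z::polish_space \<Rightarrow> ('x::polish_space \<times> 'y::polish_space) measure"
  assumes "uncountable (UNIV :: 'x set)"
    and "uncountable (UNIV :: 'y set)"
    and "uncountable (UNIV :: 'z set)"
    and "\<pi> \<in> borel \<rightarrow>\<^sub>M prob_algebra (borel \<Otimes>\<^sub>M borel)"
  defines "\<mu> \<equiv> (\<lambda>z. distr (\<pi> z) borel fst)"
    and "\<nu> \<equiv> (\<lambda>z. distr (\<pi> z) borel snd)"
  shows "\<exists>T :: 'z \<times> ('x \<times> real) \<Rightarrow> 'y \<times> real.
           T \<in> borel \<Otimes>\<^sub>M (borel \<Otimes>\<^sub>M I01) \<rightarrow>\<^sub>M borel \<Otimes>\<^sub>M I01 \<and>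
           (\<forall>z. borel_iso (borel \<Otimes>\<^sub>M I01) (borel \<Otimes>\<^sub>M I01) (\<lambda>p. T (z, p)) \<and>
                distr (\<mu> z \<Otimes>\<^sub>M lambda01) (borel \<Otimes>\<^sub>M I01) (\<lambda>p. T (z, p))
                  = \<nu> z \<Otimes>\<^sub>M lambda01 \<and>
                distr (distr (\<mu> z \<Otimes>\<^sub>M lambda01)
                             ((borel \<Otimes>\<^sub>M I01) \<Otimes>\<^sub>M (borel \<Otimes>\<^sub>M I01)) (\<lambda>p. (p, T (z, p))))
                      (borel \<Otimes>\<^sub>M borel) pr_XY
                  = \<pi> z)"
proof -
  note \<pi> [measurable] = assms(4)
  let ?PX = "(borel :: 'x measure) \<Otimes>\<^sub>M I01" and ?PY = "(borel :: 'y measure) \<Otimes>\<^sub>M I01"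
  have space_PX: "space ?PX = UNIV \<times> {0..1}" and space_PY: "space ?PY = UNIV \<times> {0..1}"
    by (auto simp: space_pair_measure)
  \<comment> \<open>With the coordinates exchanged, the same lemma supplies isomorphisms over points
    of Y.\<close>
  define \<pi>' where "\<pi>' z = distr (\<pi> z) (borel \<Otimes>\<^sub>M borel) (\<lambda>p. (snd p, fst p))" for z
  have \<pi>' [measurable]: "\<pi>' \<in> borel \<rightarrow>\<^sub>M prob_algebra (borel \<Otimes>\<^sub>M borel)"
    unfolding \<pi>'_def by measurable
  obtain A1 B1 where A1 [measurable]: "A1 \<in> ((borel :: 'z measure) \<Otimes>\<^sub>M borel) \<Otimes>\<^sub>M I01 \<rightarrow>\<^sub>M ?PY"
    and B1 [measurable]: "B1 \<in> (borel \<Otimes>\<^sub>M (borel :: 'x measure)) \<Otimes>\<^sub>M ?PY \<rightarrow>\<^sub>M I01"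
    and BA1': "\<And>z x u. z \<in> space borel \<Longrightarrow> u \<in> {0..1} \<Longrightarrow> B1 ((z, x), A1 ((z, x), u)) = u"
    and AB1': "\<And>z x p. z \<in> space borel \<Longrightarrow> snd p \<in> {0..1} \<Longrightarrow> A1 ((z, x), B1 ((z, x), p)) = p"
    and int1': "\<And>z f. z \<in> space borel \<Longrightarrow> f \<in> borel_measurable (borel \<Otimes>\<^sub>M ?PY) \<Longrightarrow>
      (\<integral>\<^sup>+q. f (fst q, A1 ((z, fst q), snd q)) \<partial>(distr (\<pi> z) borel fst \<Otimes>\<^sub>M lambda01))
        = (\<integral>\<^sup>+p. \<integral>\<^sup>+v. f (fst p, (snd p, v)) \<partial>lambda01 \<partial>\<pi> z)"
    using coupling_fibrewise_iso[OF \<pi>] by blast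
  obtain A2 B2 where A2 [measurable]: "A2 \<in> ((borel :: 'z measure) \<Otimes>\<^sub>M borel) \<Otimes>\<^sub>M I01 \<rightarrow>\<^sub>M ?PX"
    and B2 [measurable]: "B2 \<in> (borel \<Otimes>\<^sub>M (borel :: 'y measure)) \<Otimes>\<^sub>M ?PX \<rightarrow>\<^sub>M I01"
    and BA2': "\<And>z y u. z \<in> space borel \<Longrightarrow> u \<in> {0..1} \<Longrightarrow> B2 ((z, y), A2 ((z, y), u)) = u"
    and AB2': "\<And>z y p. z \<in> space borel \<Longrightarrow> snd p \<in> {0..1} \<Longrightarrow> A2 ((z, y), B2 ((z, y), p)) = p"
    and int2': "\<And>z f. z \<in> space borel \<Longrightarrow> f \<in> borel_measurable (borel \<Otimes>\<^sub>M ?PX) \<Longrightarrow>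
      (\<integral>\<^sup>+q. f (fst q, A2 ((z, fst q), snd q)) \<partial>(distr (\<pi>' z) borel fst \<Otimes>\<^sub>M lambda01))
        = (\<integral>\<^sup>+p. \<integral>\<^sup>+v. f (fst p, (snd p, v)) \<partial>lambda01 \<partial>\<pi>' z)"
    using coupling_fibrewise_iso[OF \<pi>'] by blast
  note BA1 = BA1'[unfolded space_borel, OF UNIV_I] and AB1 = AB1'[unfolded space_borel, OF UNIV_I]
    and BA2 = BA2'[unfolded space_borel, OF UNIV_I] and AB2 = AB2'[unfolded space_borel, OF UNIV_I]
    and int1 = int1'[unfolded space_borel, OF UNIV_I]
  have sets_\<pi>: "sets (\<pi> z) = sets (borel \<Otimes>\<^sub>M borel)" for z
    using kernel_prob[OF \<pi>, of z] by auto
  have int2: "(\<integral>\<^sup>+q. f (fst q, A2 ((z, fst q), snd q)) \<partial>(\<nu> z \<Otimes>\<^sub>M lambda01))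
      = (\<integral>\<^sup>+p. \<integral>\<^sup>+v. f (snd p, (fst p, v)) \<partial>lambda01 \<partial>\<pi> z)"
    if f [measurable]: "f \<in> borel_measurable (borel \<Otimes>\<^sub>M ?PX)" for z f
  proof -
    note [measurable_cong] = sets_\<pi>[of z]
    interpret lam: prob_space lambda01 by (rule prob_space_lambda01)
    have "distr (\<pi>' z) borel fst = \<nu> z"
      unfolding \<pi>'_def \<nu>_def by (subst distr_distr) (auto simp: comp_def)
    with int2'[of z, OF _ f] show ?thesis
      unfolding \<pi>'_def by (simp add: nn_integral_distr)
  qed
  \<comment> \<open>If \<open>A1\<close> over x sends u to p = (y,v), then (x,v) is coded over y by
    \<open>B2\<close>, the inverse of \<open>A2\<close>, and y is kept as first coordinate.\<close>
  define T where "T q = (let p = A1 ((fst q, fst (snd q)), snd (snd q))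
    in (fst p, B2 ((fst q, fst p), (fst (snd q), snd p))))" for q
  \<comment> \<open>The inverse: \<open>A2\<close> over y recovers (x,v), and \<open>B1\<close> over
    x codes (y,v) back into u.\<close>
  define U where "U z q = (let p = A2 ((z, fst q), snd q)
    in (fst p, B1 ((z, fst p), (fst q, snd p))))" for z q
  have T_meas [measurable]: "T \<in> borel \<Otimes>\<^sub>M ?PX \<rightarrow>\<^sub>M ?PY"
    unfolding T_def Let_def by measurable
  have A1_space: "snd (A1 ((z, x), u)) \<in> {0..1}" if "u \<in> {0..1}" for z x u
    using measurable_space[OF A1, of "((z, x), u)"] that
    by (auto simp: space_pair_measure mem_Times_iff)
  have A2_space: "snd (A2 ((z, y), u)) \<in> {0..1}" if "u \<in> {0..1}" for z y u
    using measurable_space[OF A2, of "((z, y), u)"] that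
    by (auto simp: space_pair_measure mem_Times_iff)
  show ?thesis
  proof (intro exI[of _ T] conjI allI T_meas)
    fix z
    have Tz_meas [measurable]: "(\<lambda>p. T (z, p)) \<in> ?PX \<rightarrow>\<^sub>M ?PY" by measurable
    have Uz_meas: "U z \<in> ?PY \<rightarrow>\<^sub>M ?PX" unfolding U_def Let_def by measurable
    have UT: "U z (T (z, p)) = p" if "p \<in> space ?PX" for p
      using that A1_space BA1 AB2 by (cases p) (auto simp: U_def T_def Let_def space_PX)
    have TU: "T (z, U z p) = p" if "p \<in> space ?PY" for p
      using that A2_space BA2 AB1 by (cases p) (auto simp: U_def T_def Let_def space_PY)
    have bij: "bij_betw (\<lambda>p. T (z, p)) (space ?PX) (space ?PY)"
      by (rule bij_betwI[of _ _ _ "U z"])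
         (use UT TU measurable_space[OF Tz_meas] measurable_space[OF Uz_meas] in auto)
    have "the_inv_into (space ?PX) (\<lambda>p. T (z, p)) \<in> ?PY \<rightarrow>\<^sub>M ?PX \<longleftrightarrow> U z \<in> ?PY \<rightarrow>\<^sub>M ?PX"
    proof (rule measurable_cong)
      fix p assume p: "p \<in> space ?PY"
      show "the_inv_into (space ?PX) (\<lambda>p. T (z, p)) p = U z p"
        by (rule the_inv_into_f_eq[OF bij_betw_imp_inj_on[OF bij] TU[OF p] measurable_space[OF Uz_meas p]])
    qed
    with bij Uz_meas Tz_meas show "borel_iso ?PX ?PY (\<lambda>p. T (z, p))"
      by (simp add: borel_iso_def)
    interpret lam: prob_space lambda01 by (rule prob_space_lambda01)
    note [measurable_cong] = sets_\<pi>[of z]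
    have sets_\<mu> [measurable_cong]: "sets (\<mu> z) = sets borel" and sets_\<nu> [measurable_cong]: "sets (\<nu> z) = sets borel"
      by (auto simp: \<mu>_def \<nu>_def)
    have sets_mu_lam: "sets (\<mu> z \<Otimes>\<^sub>M lambda01) = sets ?PX" and sets_nu_lam: "sets (\<nu> z \<Otimes>\<^sub>M lambda01) = sets ?PY"
      by (auto intro!: sets_pair_measure_cong sets_\<mu> sets_\<nu> sets_lambda01)
    note [measurable_cong] = sets_mu_lam sets_nu_lam
    have Tz_meas': "(\<lambda>p. T (z, p)) \<in> \<mu> z \<Otimes>\<^sub>M lambda01 \<rightarrow>\<^sub>M ?PY" by measurable
    show "distr (\<mu> z \<Otimes>\<^sub>M lambda01) ?PY (\<lambda>p. T (z, p)) = \<nu> z \<Otimes>\<^sub>M lambda01"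
    proof (rule measure_eqI)
      fix D assume "D \<in> sets (distr (\<mu> z \<Otimes>\<^sub>M lambda01) ?PY (\<lambda>p. T (z, p)))"
      then have D [measurable]: "D \<in> sets ?PY" by simp
      \<comment> \<open>Chosen so that, with coordinates exchanged, substituting \<open>A1\<close>
        gives the indicator of D after T, while substituting \<open>A2\<close> cancels
        \<open>B2\<close> and leaves the indicator of D. Both integrals equal the same integral
        against \<pi> \<otimes> \<lambda>.\<close>
      let ?f = "\<lambda>(y, xv). indicator D (y, B2 ((z, y), xv)) :: ennreal"
      have [measurable]: "?f \<in> borel_measurable (borel \<Otimes>\<^sub>M ?PX)" by measurable
      have f1: "(\<lambda>(x, (y, v)). ?f (y, (x, v))) \<in> borel_measurable (borel \<Otimes>\<^sub>M ?PY)" by measurable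
      have "emeasure (distr (\<mu> z \<Otimes>\<^sub>M lambda01) ?PY (\<lambda>p. T (z, p))) D
          = (\<integral>\<^sup>+q. indicator D (T (z, q)) \<partial>(\<mu> z \<Otimes>\<^sub>M lambda01))"
        by (rule emeasure_distr_nn_integral[OF Tz_meas' D])
      also have "\<dots> = (\<integral>\<^sup>+p. \<integral>\<^sup>+v. ?f (snd p, (fst p, v)) \<partial>lambda01 \<partial>\<pi> z)"
        using int1[OF f1, of z] by (simp add: \<mu>_def T_def Let_def split_beta')
      also have "\<dots> = (\<integral>\<^sup>+q. ?f (fst q, A2 ((z, fst q), snd q)) \<partial>(\<nu> z \<Otimes>\<^sub>M lambda01))"
        by (rule int2[symmetric]) measurable
      also have "\<dots> = (\<integral>\<^sup>+q. indicator D q \<partial>(\<nu> z \<Otimes>\<^sub>M lambda01))"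
        by (rule nn_integral_cong) (auto simp: space_pair_measure BA2)
      also have "\<dots> = emeasure (\<nu> z \<Otimes>\<^sub>M lambda01) D"
        using D by (simp add: sets_nu_lam)
      finally show "emeasure (distr (\<mu> z \<Otimes>\<^sub>M lambda01) ?PY (\<lambda>p. T (z, p))) D = emeasure (\<nu> z \<Otimes>\<^sub>M lambda01) D" .
    qed (simp add: sets_nu_lam)
    have pr_meas: "pr_XY \<in> ?PX \<Otimes>\<^sub>M ?PY \<rightarrow>\<^sub>M borel \<Otimes>\<^sub>M borel"
      unfolding pr_XY_def by measurable
    have graph_meas: "(\<lambda>p. (p, T (z, p))) \<in> \<mu> z \<Otimes>\<^sub>M lambda01 \<rightarrow>\<^sub>M ?PX \<Otimes>\<^sub>M ?PY" by measurable
    show "distr (distr (\<mu> z \<Otimes>\<^sub>M lambda01) (?PX \<Otimes>\<^sub>M ?PY) (\<lambda>p. (p, T (z, p)))) (borel \<Otimes>\<^sub>M borel) pr_XY = \<pi> z"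
    proof (rule measure_eqI)
      fix D assume "D \<in> sets (distr (distr (\<mu> z \<Otimes>\<^sub>M lambda01) (?PX \<Otimes>\<^sub>M ?PY) (\<lambda>p. (p, T (z, p)))) (borel \<Otimes>\<^sub>M borel) pr_XY)"
      then have D [measurable]: "D \<in> sets (borel \<Otimes>\<^sub>M borel)" by simp
      \<comment> \<open>The Y-coordinate of \<open>T\<close> is that of \<open>A1\<close>, so the
        test function is constant in v and integrating over \<lambda> contributes a factor
        1.\<close>
      have f1: "(\<lambda>(x, (y, v)). indicator D (x, y) :: ennreal) \<in> borel_measurable (borel \<Otimes>\<^sub>M ?PY)" by measurable
      have "emeasure (distr (distr (\<mu> z \<Otimes>\<^sub>M lambda01) (?PX \<Otimes>\<^sub>M ?PY) (\<lambda>p. (p, T (z, p)))) (borel \<Otimes>\<^sub>M borel) pr_XY) D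
          = (\<integral>\<^sup>+q. indicator D (pr_XY (q, T (z, q))) \<partial>(\<mu> z \<Otimes>\<^sub>M lambda01))"
        unfolding distr_distr[OF pr_meas graph_meas]
        using emeasure_distr_nn_integral[OF measurable_comp[OF graph_meas pr_meas] D] by simp
      also have "\<dots> = (\<integral>\<^sup>+p. \<integral>\<^sup>+v. indicator D p \<partial>lambda01 \<partial>\<pi> z)"
        using int1[OF f1, of z] by (simp add: \<mu>_def T_def Let_def split_beta' pr_XY_def)
      also have "\<dots> = emeasure (\<pi> z) D"
        using D lam.emeasure_space_1 by (simp add: sets_\<pi>)
      finally show "emeasure (distr (distr (\<mu> z \<Otimes>\<^sub>M lambda01) (?PX \<Otimes>\<^sub>M ?PY) (\<lambda>p. (p, T (z, p)))) (borel \<Otimes>\<^sub>M borel) pr_XY) D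
          = emeasure (\<pi> z) D" .
    qed (simp add: sets_\<pi>)
  qed
qed

end
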